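(* Let $n\ge 2$ and let $a_1,\ldots,a_n,b_1,\ldots,b_n\in\mathbb{Z}_+$ with $a_i\le a_{i+1}$ and $b_i\le b_{i+1}$ for all $i=1,\ldots,n-1$. Let $A=[a_1,\ldots,a_n]$ and $B=[b_1,\ldots,b_n]$ be the corresponding multisets. Assume that $$\prod_{i=1}^n\frac{1-q^{a_i}}{1-q^{b_i}}\in\mathbb{Z}[q],$$ and assume further that $$2b_n\left\lfloor\frac{b_{n-1}}{2}\right\rfloor-b_1<a_1.$$ Then for every subset of indices $I\subseteq\{1,\ldots,n\}$, $$\#\bigl(A\,\overline{\cap}\,\langle \mathrm{set}(B_I)\rangle_{\mathrm{semigroup}}\bigr)\ge\# I.$$ In particular, $$\prod_{i=1}^n\frac{1-q^{a_i}}{1-q^{b_i}}\in\mathbb{Z}_{\ge 0}[q],$$ i.e. this polynomial has non-negative integer coefficients.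
   Context: $\mathbb{Z}_+$ and $\mathbb{Z}_{\ge 0}$ denote the positive and the non-negative integers. Square brackets denote multisets. For a multiset $S$, $\mathrm{set}(S)$ is its underlying set and $\#S$ its cardinality counted with multiplicity. For an indexed multiset $S=[s_1,\ldots,s_n]$ and $I\subseteq\{1,\ldots,n\}$, $S_I:=[s_i : i\in I]$. For a multiset $S$ and a set $S'$, $S\,\overline{\cap}\,S':=[s\in S: s\in S']$ (elements of $S$, kept with their multiplicity in $S$, that lie in $S'$). For a finite set $S=\{s_1,\ldots,s_r\}\subset\mathbb{Z}_+$, $\langle S\rangle_{\mathrm{semigroup}}:=\{c_1s_1+\cdots+c_rs_r : c_i\in\mathbb{Z}_{\ge 0}\}$ (so $\langle\emptyset\rangle_{\mathrm{semigroup}}=\{0\}$). *)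

theory Defs
  imports
    "HOL-Library.Multiset"
    "HOL-Computational_Algebra.Polynomial"
    "HOL-Computational_Algebra.Polynomial_Factorial"
begin

definition sub_mset :: "(nat \<Rightarrow> 'a) \<Rightarrow> nat set \<Rightarrow> 'a multiset" where
  "sub_mset s I = image_mset s (mset_set I)"

definition mset_cap :: "'a multiset \<Rightarrow> 'a set \<Rightarrow> 'a multiset" (infixl "\<inter>\<^sub>#\<^sub>s" 70) where
  "S \<inter>\<^sub>#\<^sub>s T = {#s \<in># S. s \<in> T#}"

text \<open>Meaningful for finite \<open>S\<close> only: for infinite \<open>S\<close> the sum is \<open>0\<close> by convention.\<close>

definition semigroup_span :: "nat set \<Rightarrow> nat set" where
  "semigroup_span S = {\<Sum>s\<in>S. c s * s | c :: nat \<Rightarrow> nat. True}"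

text \<open>The product as a rational function, that is, an element of the fraction field of
  \<open>\<int>[q]\<close>, into which \<^const>\<open>to_fract\<close> embeds \<open>\<int>[q]\<close>; the indeterminate \<open>q\<close> is
  \<open>monom 1 1\<close>. The denominators are nonzero because they are only used with positive \<open>b i\<close>.\<close>

definition q_quotient :: "nat \<Rightarrow> (nat \<Rightarrow> nat) \<Rightarrow> (nat \<Rightarrow> nat) \<Rightarrow> int poly fract" where
  "q_quotient n a b =
     (\<Prod>i=1..n. to_fract (1 - monom 1 1 ^ a i) / to_fract (1 - monom 1 1 ^ b i))"

definition int_polys :: "int poly fract set" where
  "int_polys = range to_fract"

definition nonneg_int_polys :: "int poly fract set" where
  "nonneg_int_polys = to_fract ` {p. \<forall>k. coeff p k \<ge> 0}"

end

theory Submission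
  imports Defs "HOL-Library.Poly_Mapping" "HOL-Library.FuncSet"
    "HOL-Computational_Algebra.Polynomial_FPS" Complex_Main
begin

text \<open>
  If the quotient is a polynomial, comparing orders of vanishing at a
  primitive \<open>d\<close>-th root of unity shows that at least as many \<open>a i\<close> as \<open>b i\<close> are divisible by
  \<open>d\<close> (\<open>card_multiples_le\<close>). For \<open>d\<close> the gcd of the \<open>b i\<close> with \<open>i \<in> I\<close> this gives \<open>card I\<close> many \<open>a j\<close>
  that are multiples of \<open>d\<close>. By Schur's bound on Frobenius numbers
  (\<open>multiple_of_Gcd_in_semigroup_span\<close>) a multiple of the gcd of a finite set lies in the semigroup
  generated by the set as soon as it is large enough, and the lower bound on the smallest \<open>a j\<close>
  is large enough for every \<open>I\<close>.

  This counting statement alone implies nonnegativity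
  (\<open>nonneg_quotient_of_semigroup_condition\<close>), because the quotient is then a Hilbert series. Let
  \<open>R\<close> be the polynomial ring over the rationals in variables \<open>x i\<close> of degree \<open>b i\<close>, whose Hilbert
  series is the product of the \<open>1 / (1 - q ^ b i)\<close>. Dividing by a form of degree \<open>a j\<close> that is not a
  zero divisor multiplies the series by \<open>1 - q ^ a j\<close>; so if forms \<open>f j\<close> of degrees \<open>a j\<close> are a regular
  sequence, the quotient in question is the Hilbert series of \<open>R\<close> modulo these forms, and its
  coefficients are dimensions.

  Such forms exist: take generic ones. On the stratum where exactly the variables with index in
  \<open>I\<close> are nonzero, a generic form of degree \<open>a j\<close> is nonzero if and only if \<open>a j\<close> lies in the
  semigroup generated by the \<open>b i\<close> with \<open>i \<in> I\<close>. Up to scaling the stratum has dimension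
  \<open>card I - 1\<close>, and there are at least \<open>card I\<close> generic equations on it, hence no solutions. Over a
  ring this reads: the product of the \<open>x i\<close> with \<open>i \<in> I\<close> is nilpotent modulo the forms and the other
  variables. It is proved by linear algebra: too many products of bounded degree in too small
  a space satisfy a linear relation, and the relation excludes only few values of a coefficient
  (\<open>few_bad_coefficients\<close>, \<open>generic_parameters_exist\<close>). Assembling all strata, every variable is
  nilpotent modulo the forms (\<open>variables_in_ideal_radical\<close>).

  Nilpotency is turned into regularity by exchanging one form at a time. If \<open>g\<close> is a
  nonzerodivisor modulo a family and \<open>g ^ N = w + f * h\<close> with \<open>w\<close> in the ideal of the family, then \<open>f\<close> is
  a nonzerodivisor as well (\<open>regular_exchange\<close>). The exchange starts with the variables, which are
  regular, replaces them by generic forms of a common degree \<open>L\<close> divisible by all \<open>b i\<close>, and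
  replaces these by the generic forms of degrees \<open>a j\<close>. The detour through \<open>L\<close> makes all intermediate families
  have finite-dimensional quotients: a generic form of degree \<open>L\<close> vanishes on no stratum, so it
  counts as an equation for every \<open>I\<close>, whichever forms have been replaced already.
\<close>

section \<open>Numerical semigroups\<close>

lemma semigroup_span_0: "0 \<in> semigroup_span S"
  unfolding semigroup_span_def by (rule CollectI, rule exI[of _ "\<lambda>_. 0"]) simp

lemma semigroup_span_add:
  assumes "u \<in> semigroup_span S" "v \<in> semigroup_span S"
  shows "u + v \<in> semigroup_span S"
proof -
  from assms obtain c d where "u = (\<Sum>s\<in>S. c s * s)" "v = (\<Sum>s\<in>S. d s * s)"
    unfolding semigroup_span_def by blast
  then have "u + v = (\<Sum>s\<in>S. (c s + d s) * s)"
    by (simp add: sum.distrib algebra_simps)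
  then show ?thesis unfolding semigroup_span_def
    by (intro CollectI exI[of _ "\<lambda>s. c s + d s"]) simp
qed

lemma semigroup_span_base:
  assumes "finite S" "s \<in> S" shows "s \<in> semigroup_span S"
proof -
  have "(\<Sum>t\<in>S. of_bool (t = s) * t) = (\<Sum>t\<in>S. if t = s then t else 0)"
    by (rule sum.cong) auto
  also have "\<dots> = s" using assms by simp
  finally show ?thesis
    unfolding semigroup_span_def by (intro CollectI exI[of _ "\<lambda>t. of_bool (t = s)"]) simp
qed

lemma semigroup_span_mult:
  assumes "u \<in> semigroup_span S" shows "k * u \<in> semigroup_span S"
  by (induction k) (use assms in \<open>auto simp: semigroup_span_0 intro: semigroup_span_add\<close>)

lemma sum_list_in_semigroup_span:
  assumes "finite S" "set xs \<subseteq> S" shows "sum_list xs \<in> semigroup_span S"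
  using assms(2)
proof (induction xs)
  case Nil then show ?case by (simp add: semigroup_span_0)
next
  case (Cons x xs)
  then show ?case using semigroup_span_add[OF semigroup_span_base[OF assms(1), of x]] by simp
qed

text \<open>Bezout's identity, applied to one element of \<open>S\<close> after the other.\<close>

lemma int_subgroup_contains_Gcd:
  fixes G :: "int set"
  assumes "0 \<in> G" and add: "\<And>x y. x \<in> G \<Longrightarrow> y \<in> G \<Longrightarrow> x + y \<in> G"
    and neg: "\<And>x. x \<in> G \<Longrightarrow> - x \<in> G" and "finite S" "S \<subseteq> G"
  shows "Gcd S \<in> G"
proof -
  have natmult: "int k * x \<in> G" if "x \<in> G" for k x
    by (induction k) (auto simp: assms(1) algebra_simps intro: add that)
  have mult: "k * x \<in> G" if "x \<in> G" for k x
  proof (cases "k \<ge> 0")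
    case True then show ?thesis using natmult[OF that, of "nat k"] by simp
  next
    case False then show ?thesis using neg[OF natmult[OF that, of "nat (-k)"]] by simp
  qed
  show ?thesis using \<open>finite S\<close> \<open>S \<subseteq> G\<close>
  proof (induction S rule: finite_induct)
    case empty then show ?case using assms(1) by simp
  next
    case (insert x S)
    obtain u v where "u * x + v * Gcd S = gcd x (Gcd S)" using bezout_int by blast
    then show ?case using insert by (metis Gcd_insert add insert_subset mult)
  qed
qed

text \<open>The residues modulo \<open>s\<close> of sums of elements of \<open>S\<close> form a subgroup: as \<open>s * x\<close> vanishes
  modulo \<open>s\<close>, the inverse of \<open>x\<close> is \<open>(s - 1) * x\<close>. So subtraction is available although only
  nonnegative combinations are allowed, and the gcd is among the residues.\<close>

lemma residue_by_generators:
  fixes S :: "nat set"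
  assumes "finite S" "s \<in> S" "s > 0" "Gcd S dvd N"
  shows "\<exists>xs. set xs \<subseteq> S \<and> sum_list xs mod s = N mod s"
proof -
  define G where "G = {z::int. \<exists>xs. set xs \<subseteq> S \<and> int (sum_list xs) mod int s = z mod int s}"
  have G0: "0 \<in> G" unfolding G_def by (rule CollectI, rule exI[of _ "[]"]) simp
  have Gadd: "x + y \<in> G" if x: "x \<in> G" and y: "y \<in> G" for x y
  proof -
    from x y obtain xs ys where "set xs \<subseteq> S" "int (sum_list xs) mod int s = x mod int s"
      "set ys \<subseteq> S" "int (sum_list ys) mod int s = y mod int s" unfolding G_def by blast
    then have "set (xs @ ys) \<subseteq> S" "int (sum_list (xs @ ys)) mod int s = (x + y) mod int s"
      by (auto intro: mod_add_cong)
    then show ?thesis unfolding G_def by blast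
  qed
  have Gmult: "int k * x \<in> G" if "x \<in> G" for k x
    by (induction k) (auto simp: G0 algebra_simps intro: Gadd that)
  have Gneg: "- x \<in> G" if "x \<in> G" for x
  proof -
    have "int (s - 1) * x \<in> G" using Gmult[OF that] .
    moreover have "(int (s - 1) * x) mod int s = (- x) mod int s"
    proof -
      have "int (s - 1) * x = int s * x + - x" using \<open>s > 0\<close> by (simp add: of_nat_diff algebra_simps)
      then show ?thesis by (metis mod_mult_self3 mult.commute)
    qed
    ultimately show ?thesis unfolding G_def by simp
  qed
  have "int ` S \<subseteq> G" unfolding G_def
  proof clarify
    fix x assume "x \<in> S"
    then show "\<exists>xs. set xs \<subseteq> S \<and> int (sum_list xs) mod int s = int x mod int s"
      by (intro exI[of _ "[x]"]) simp
  qed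
  then have "Gcd (int ` S) \<in> G"
    using int_subgroup_contains_Gcd[of G "int ` S"] G0 Gadd Gneg assms(1) by blast
  then have "int (Gcd S) \<in> G" by (simp add: Gcd_int_eq)
  moreover from assms(4) obtain k where "N = Gcd S * k" by (rule dvdE)
  ultimately have "int N \<in> G" using Gmult[of "int (Gcd S)" k] by (simp add: mult.commute)
  then obtain xs where "set xs \<subseteq> S" "int (sum_list xs) mod int s = int N mod int s"
    unfolding G_def by blast
  then show ?thesis by (metis of_nat_eq_iff of_nat_mod)
qed

text \<open>In a shortest list with the given residue, no two prefix sums are congruent modulo \<open>s\<close>,
  since the block between them could be cut out; a list with \<open>s\<close> or more entries has too many
  prefixes for that.\<close>

lemma short_residue_by_generators:
  fixes S :: "nat set"
  assumes "finite S" "s \<in> S" "s > 0" "Gcd S dvd N"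
  shows "\<exists>xs. set xs \<subseteq> S \<and> sum_list xs mod s = N mod s \<and> length xs < s"
proof -
  define P where "P xs \<longleftrightarrow> set xs \<subseteq> S \<and> sum_list xs mod s = N mod s" for xs
  have "\<exists>xs. P xs" unfolding P_def by (rule residue_by_generators[OF assms])
  then obtain xs where xs: "P xs" and minimal: "\<And>ys. P ys \<Longrightarrow> length xs \<le> length ys"
    using ex_has_least_nat[of P _ length] by blast
  have "length xs < s"
  proof (rule ccontr)
    assume long: "\<not> length xs < s"
    let ?f = "\<lambda>i. sum_list (take i xs) mod s"
    have "?f ` {..s} \<subseteq> {..<s}" using \<open>s > 0\<close> by auto
    then have "card (?f ` {..s}) < card {..s}"
      using card_mono[of "{..<s}" "?f ` {..s}"] by simp
    then have "\<not> inj_on ?f {..s}" by (rule pigeonhole)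
    then obtain i j where ij: "i < j" "j \<le> s" "?f i = ?f j"
      unfolding inj_on_def by (metis atMost_iff linorder_neqE_nat)
    define ys where "ys = take i xs @ drop j xs"
    have "sum_list xs = sum_list (take j xs) + sum_list (drop j xs)"
      by (metis append_take_drop_id sum_list_append)
    then have "sum_list ys mod s = sum_list xs mod s"
      unfolding ys_def using mod_add_cong[OF ij(3) refl, of "sum_list (drop j xs)"] by simp
    moreover have "set ys \<subseteq> set xs"
      unfolding ys_def by (auto dest: in_set_takeD in_set_dropD)
    ultimately have "P ys" using xs unfolding P_def by auto
    then have "length xs \<le> length ys" by (rule minimal)
    moreover have "length ys < length xs" unfolding ys_def using ij long by auto
    ultimately show False by simp
  qed
  then show ?thesis using xs unfolding P_def by blast
qed

text \<open>Schur's bound: for coprime generators with minimum \<open>s\<close> and maximum \<open>t\<close>, the largest integer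
  that is not in the semigroup is at most \<open>(s - 1) * t - s\<close>. The residue class of \<open>N\<close> modulo \<open>s\<close>
  contains a sum of fewer than \<open>s\<close> generators, which is at most \<open>(s - 1) * t\<close> and hence less than
  \<open>N + s\<close>. Being congruent to \<open>N\<close> it does not exceed \<open>N\<close>, and adding copies of \<open>s\<close> to it
  reaches \<open>N\<close>.\<close>

lemma multiple_of_Gcd_in_semigroup_span:
  fixes S :: "nat set"
  assumes "finite S" "s \<in> S" "s > 0" "Gcd S dvd N"
    and upper: "\<And>x. x \<in> S \<Longrightarrow> x \<le> t" and large: "(s - 1) * t < N + s"
  shows "N \<in> semigroup_span S"
proof -
  obtain xs where xs: "set xs \<subseteq> S" "sum_list xs mod s = N mod s" "length xs < s"
    using short_residue_by_generators[OF assms(1-4)] by blast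
  have "sum_list xs \<le> length xs * t"
    using xs(1) upper by (induction xs) (auto intro: add_mono)
  also have "\<dots> \<le> (s - 1) * t" using xs(3) by (intro mult_right_mono) auto
  finally have bound: "sum_list xs < N + s" using large by simp
  have "sum_list xs \<le> N"
  proof (rule ccontr)
    assume "\<not> sum_list xs \<le> N"
    then have "s dvd sum_list xs - N" "0 < sum_list xs - N"
      using mod_eq_dvd_iff_nat[of N "sum_list xs" s] xs(2) by auto
    then have "s \<le> sum_list xs - N" by (rule dvd_imp_le)
    then show False using bound \<open>s > 0\<close> by linarith
  qed
  then have "s dvd N - sum_list xs"
    using mod_eq_dvd_iff_nat[of "sum_list xs" N s] xs(2) by auto
  then obtain k where "N - sum_list xs = s * k" by (rule dvdE)
  then have "N = sum_list xs + k * s"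
    using \<open>sum_list xs \<le> N\<close> by (simp add: mult.commute)
  moreover have "sum_list xs + k * s \<in> semigroup_span S"
    by (intro semigroup_span_add sum_list_in_semigroup_span semigroup_span_mult semigroup_span_base assms xs)
  ultimately show ?thesis by simp
qed

section \<open>Divisibility counts from cyclotomic factors\<close>

lemma order_prod:
  assumes "finite S" "\<And>i. i \<in> S \<Longrightarrow> f i \<noteq> (0 :: 'a::idom poly)"
  shows "order z (prod f S) = (\<Sum>i\<in>S. order z (f i))"
  using assms
  by (induction S rule: finite_induct) (auto simp: order_mult prod_zero_iff)

lemma one_minus_monom_nonzero:
  assumes "m > 0" shows "1 - monom 1 m \<noteq> (0 :: 'a::comm_ring_1 poly)"
proof
  assume "1 - monom 1 m = (0 :: 'a poly)"
  then have "coeff (1 - monom 1 m :: 'a poly) 0 = 0" by simp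
  then show False using assms by simp
qed

text \<open>All roots of \<open>1 - q ^ m\<close> are simple, because its derivative vanishes at \<open>0\<close> only.\<close>

lemma order_one_minus_monom:
  assumes "m > 0" "d > 0"
  shows "order (cis (2 * pi / real d)) (1 - monom 1 m) = (if d dvd m then 1 else 0)"
proof -
  let ?z = "cis (2 * pi / real d)" and ?p = "1 - monom 1 m :: complex poly"
  have nz: "?p \<noteq> 0" using assms(1) by (rule one_minus_monom_nonzero)
  have root_iff: "poly ?p ?z = 0 \<longleftrightarrow> d dvd m"
  proof -
    have "poly ?p ?z = 0 \<longleftrightarrow> cis (2 * pi * (real m / real d)) = 1"
      by (simp add: poly_monom DeMoivre mult.commute)
    also have "\<dots> \<longleftrightarrow> (\<exists>k::int. real m / real d = of_int k)"
    proof
      assume "cis (2 * pi * (real m / real d)) = 1"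
      then have "cos (2 * pi * (real m / real d)) = 1" by (metis cis.sel(1) one_complex.sel(1))
      then obtain k::int where k: "2 * pi * (real m / real d) = of_int k * 2 * pi"
        unfolding cos_one_2pi_int by blast
      have "real m / real d * (2 * pi) = of_int k * (2 * pi)" by (metis k mult.assoc mult.commute)
      then have "real m / real d = of_int k" using pi_gt_zero by (metis mult_right_cancel less_numeral_extra(3) mult_pos_pos zero_less_numeral)
      then show "\<exists>k::int. real m / real d = of_int k" by blast
    next
      assume "\<exists>k::int. real m / real d = of_int k"
      then show "cis (2 * pi * (real m / real d)) = 1"
        by (metis Ints_of_int cis_multiple_2pi)
    qed
    also have "\<dots> \<longleftrightarrow> (\<exists>k::int. int m = k * int d)"
    proof -
      have "real m / real d = of_int k \<longleftrightarrow> real_of_int (int m) = real_of_int (k * int d)" for k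
        using assms(2) by (simp add: nonzero_divide_eq_eq)
      then show ?thesis unfolding of_int_eq_iff by simp
    qed
    also have "\<dots> \<longleftrightarrow> int d dvd int m" by (simp add: dvd_def mult.commute)
    finally show ?thesis by simp
  qed
  show ?thesis
  proof (cases "d dvd m")
    case False then show ?thesis using root_iff by (simp add: order_0I)
  next
    case True
    have pd: "pderiv ?p = - monom (of_nat m) (m - 1)"
      by (simp add: pderiv_diff pderiv_monom)
    have "poly (pderiv ?p) ?z \<noteq> 0" using assms(1) by (simp add: pd poly_monom)
    then have "pderiv ?p \<noteq> 0" "order ?z (pderiv ?p) = 0" by (auto simp: order_0I)
    moreover have "order ?z ?p \<noteq> 0" using True root_iff nz order_root by blast
    ultimately have "order ?z ?p = Suc 0" using order_pderiv2 by blast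
    then show ?thesis using True by simp
  qed
qed

lemma map_poly_of_int_mult:
  "map_poly (of_int :: int \<Rightarrow> 'a::comm_ring_1) (p * q) = map_poly of_int p * map_poly of_int q"
  by (rule poly_eqI) (simp add: coeff_map_poly coeff_mult)

lemma map_poly_of_int_prod:
  "map_poly (of_int :: int \<Rightarrow> 'a::comm_ring_1) (prod f S) = (\<Prod>i\<in>S. map_poly of_int (f i))"
  by (induction S rule: infinite_finite_induct) (simp_all add: map_poly_of_int_mult)

text \<open>Both sides are orders of vanishing at a primitive \<open>d\<close>-th root of unity, of the denominator and
  of the numerator; the polynomial \<open>p\<close> contributes a nonnegative order.\<close>

lemma card_multiples_le:
  fixes a b :: "'i \<Rightarrow> nat" and p :: "int poly"
  assumes "finite S" and a: "\<And>i. i \<in> S \<Longrightarrow> a i > 0" and b: "\<And>i. i \<in> S \<Longrightarrow> b i > 0" and "d > 0"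
    and eq: "p * (\<Prod>i\<in>S. 1 - monom 1 (b i)) = (\<Prod>i\<in>S. 1 - monom 1 (a i))"
  shows "card {i \<in> S. d dvd b i} \<le> card {i \<in> S. d dvd a i}"
proof -
  let ?h = "map_poly of_int :: int poly \<Rightarrow> complex poly" and ?z = "cis (2 * pi / real d)"
  have h: "?h (1 - monom 1 m) = 1 - monom 1 m" for m
    by (rule poly_eqI) (auto simp: coeff_map_poly)
  have ord: "order ?z (\<Prod>i\<in>S. 1 - monom 1 (c i)) = card {i \<in> S. d dvd c i}"
    if "\<And>i. i \<in> S \<Longrightarrow> c i > 0" for c :: "'i \<Rightarrow> nat"
  proof -
    have "order ?z (\<Prod>i\<in>S. 1 - monom 1 (c i)) = (\<Sum>i\<in>S. order ?z (1 - monom 1 (c i)))"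
      by (intro order_prod \<open>finite S\<close> one_minus_monom_nonzero that)
    also have "\<dots> = (\<Sum>i\<in>S. if d dvd c i then 1 else 0)"
      by (intro sum.cong refl order_one_minus_monom that \<open>d > 0\<close>)
    also have "\<dots> = card {i \<in> S. d dvd c i}"
      using \<open>finite S\<close> by (simp add: sum.If_cases Int_def)
    finally show ?thesis .
  qed
  have "?h p * (\<Prod>i\<in>S. 1 - monom 1 (b i)) = (\<Prod>i\<in>S. 1 - monom 1 (a i))"
    using arg_cong[OF eq, of ?h] by (simp add: map_poly_of_int_mult map_poly_of_int_prod h)
  moreover have "(\<Prod>i\<in>S. 1 - monom 1 (a i)) \<noteq> (0 :: complex poly)"
    using a one_minus_monom_nonzero \<open>finite S\<close> using prod_zero_iff[OF \<open>finite S\<close>] by (metis (no_types, lifting))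
  ultimately have "order ?z (\<Prod>i\<in>S. 1 - monom 1 (a i)) = order ?z (?h p) + order ?z (\<Prod>i\<in>S. 1 - monom 1 (b i))"
    using order_mult[of "?h p" "\<Prod>i\<in>S. 1 - monom 1 (b i)" ?z] by simp
  then show ?thesis using ord[OF a] ord[OF b] by simp
qed

section \<open>Dimensions of finite-dimensional subspaces\<close>

context vector_space
begin

lemma finite_basis_extension:
  assumes "A \<subseteq> V" "independent A" "V \<subseteq> span Y" "finite Y"
  obtains B where "A \<subseteq> B" "B \<subseteq> V" "independent B" "V \<subseteq> span B" "finite B" "card B = dim V"
proof -
  obtain B where B: "A \<subseteq> B" "B \<subseteq> V" "independent B" "V \<subseteq> span B"
    using maximal_independent_subset_extend[OF assms(1,2)] by blast
  moreover have "finite B" using independent_span_bound[OF assms(4) B(3)] B(2) assms(3) by blast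
  moreover have "card B = dim V" using basis_card_eq_dim[OF B(2,4,3)] .
  ultimately show thesis using that by blast
qed

lemma finite_basis:
  assumes "V \<subseteq> span Y" "finite Y"
  obtains B where "B \<subseteq> V" "independent B" "V \<subseteq> span B" "finite B" "card B = dim V"
  by (rule finite_basis_extension[OF empty_subsetI independent_empty assms])

lemma dim_zero_subspace: "dim {0} = 0"
  using dim_le_card[of "{0}" "{}"] by simp

lemma dim_subset_le:
  assumes "U \<subseteq> V" "V \<subseteq> span Y" "finite Y"
  shows "dim U \<le> dim V"
proof -
  obtain A where A: "A \<subseteq> U" "independent A" "U \<subseteq> span A" "card A = dim U"
    by (rule finite_basis[of U Y]) (use assms in auto)
  obtain B where "A \<subseteq> B" "finite B" "card B = dim V"
    by (rule finite_basis_extension[of A V Y]) (use A assms in auto)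
  then show ?thesis using A(4) card_mono by metis
qed

lemma subspace_eqI_dim:
  assumes "subspace U" "U \<subseteq> V" "V \<subseteq> span Y" "finite Y" "dim U = dim V"
  shows "U = V"
proof -
  obtain A where A: "A \<subseteq> U" "independent A" "U \<subseteq> span A" "card A = dim U"
    by (rule finite_basis[of U Y]) (use assms in auto)
  obtain B where B: "A \<subseteq> B" "finite B" "card B = dim V" "V \<subseteq> span B"
    by (rule finite_basis_extension[of A V Y]) (use A assms in auto)
  then have "A = B" using A(4) assms(5) by (simp add: card_subset_eq)
  then have "V \<subseteq> U" using B(4) span_minimal[OF A(1) assms(1)] by simp
  then show ?thesis using assms(2) by blast
qed

text \<open>The vectors are given as a family, since in the application different indices may yield
  equal vectors.\<close>

lemma linear_relation_of_card:
  assumes "finite U" "finite Y" "\<And>u. u \<in> U \<Longrightarrow> f u \<in> span Y" "card Y < card U"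
  shows "\<exists>h. (\<exists>u\<in>U. h u \<noteq> 0) \<and> (\<Sum>u\<in>U. scale (h u) (f u)) = 0"
proof (cases "inj_on f U")
  case False
  then obtain u u' where u: "u \<in> U" "u' \<in> U" "u \<noteq> u'" "f u = f u'" unfolding inj_on_def by blast
  define h where "h v = (if v = u then 1 else if v = u' then - 1 else 0 :: 'a)" for v
  have "(\<Sum>v\<in>U. scale (h v) (f v)) = (\<Sum>v\<in>{u, u'}. scale (h v) (f v))"
    by (rule sum.mono_neutral_right) (use u assms(1) in \<open>auto simp: h_def\<close>)
  also have "\<dots> = 0" using u by (simp add: h_def)
  finally show ?thesis using u(1) by (intro exI[of _ h]) (auto simp: h_def)
next
  case True
  have "dependent (f ` U)"
  proof (rule ccontr)
    assume "\<not> dependent (f ` U)"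
    then have "card (f ` U) \<le> card Y"
      using independent_span_bound[OF assms(2)] assms(3) by blast
    then show False using assms(4) True by (simp add: card_image)
  qed
  then obtain g where g: "\<exists>v\<in>f ` U. g v \<noteq> 0" "(\<Sum>v\<in>f ` U. scale (g v) v) = 0"
    using dependent_finite[of "f ` U"] assms(1) by blast
  then show ?thesis by (intro exI[of _ "g \<circ> f"]) (auto simp: sum.reindex[OF True])
qed

text \<open>Rank-nullity for the map that \<open>T\<close> induces from \<open>V\<close> to the ambient space modulo \<open>W\<close>: a basis of
  its kernel is extended to a basis of \<open>V\<close>, and the images of the added vectors complete a basis
  of \<open>W\<close>.\<close>

lemma dim_sum_image:
  assumes T_add: "\<And>x y. T (x + y) = T x + T y" and T_scale: "\<And>c x. T (scale c x) = scale c (T x)"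
    and V: "subspace V" "V \<subseteq> span Y" and W: "subspace W" "W \<subseteq> span Y'" and fin: "finite Y" "finite Y'"
  shows "dim {w + T v | w v. w \<in> W \<and> v \<in> V} + dim {v \<in> V. T v \<in> W} = dim W + dim V"
proof -
  let ?K = "{v \<in> V. T v \<in> W}" and ?S = "{w + T v | w v. w \<in> W \<and> v \<in> V}"
  have T0: "T 0 = 0" using T_scale[of 0 0] by simp
  have T_diff: "T (x - y) = T x - T y" for x y
    using T_add[of "x - y" y] by (simp add: algebra_simps)
  have T_sum: "T (\<Sum>x\<in>A. f x) = (\<Sum>x\<in>A. T (f x))" for f and A :: "'b set"
    by (induction A rule: infinite_finite_induct) (simp_all add: T0 T_add)
  have K: "subspace ?K"
    using V(1) W(1) by (auto simp: subspace_def T0 T_add T_scale)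
  obtain BK where BK: "BK \<subseteq> ?K" "independent BK" "?K \<subseteq> span BK" "finite BK" "card BK = dim ?K"
    by (rule finite_basis[of ?K Y]) (use V(2) fin(1) in auto)
  obtain BV where BV: "BK \<subseteq> BV" "BV \<subseteq> V" "independent BV" "V \<subseteq> span BV" "finite BV" "card BV = dim V"
    by (rule finite_basis_extension[of BK V Y]) (use BK(1,2) V(2) fin(1) in auto)
  obtain BW where BW: "BW \<subseteq> W" "independent BW" "W \<subseteq> span BW" "finite BW" "card BW = dim W"
    by (rule finite_basis[OF W(2) fin(2)])
  define C where "C = BV - BK"
  have C: "C \<subseteq> V" "finite C" "C \<inter> BK = {}" "BV = BK \<union> C" using BV BK unfolding C_def by auto
  have not_span: "c \<notin> span (BV - {c})" if "c \<in> C" for c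
    using BV(3) that C(4) unfolding dependent_def by blast
  have inj: "inj_on T C"
  proof (rule inj_onI, rule ccontr)
    fix c c' assume c: "c \<in> C" "c' \<in> C" "T c = T c'" "c \<noteq> c'"
    then have "c - c' \<in> ?K" using C(1) V(1) subspace_0[OF W(1)] by (auto simp: T_diff intro: subspace_diff)
    then have "c - c' \<in> span (BV - {c})" using BK(3) c(1) C(3,4) span_mono[of BK "BV - {c}"] by blast
    moreover have "c' \<in> span (BV - {c})" using c C(4) by (intro span_base) auto
    ultimately have "(c - c') + c' \<in> span (BV - {c})" by (rule span_add)
    then show False using not_span[OF c(1)] by simp
  qed
  have disj: "BW \<inter> T ` C = {}"
  proof (rule ccontr)
    assume "BW \<inter> T ` C \<noteq> {}"
    then obtain c where c: "c \<in> C" "T c \<in> BW" by blast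
    then have "c \<in> span BK" using BW(1) C(1) BK(3) by blast
    then have "c \<in> span (BV - {c})" using c(1) C(3,4) span_mono[of BK "BV - {c}"] by blast
    then show False using not_span[OF c(1)] by simp
  qed
  have indep: "independent (BW \<union> T ` C)"
  proof (rule independent_if_scalars_zero)
    show "finite (BW \<union> T ` C)" using BW(4) C(2) by simp
    fix f x assume sum0: "(\<Sum>x\<in>BW \<union> T ` C. scale (f x) x) = 0" and x: "x \<in> BW \<union> T ` C"
    have split: "(\<Sum>x\<in>BW. scale (f x) x) + (\<Sum>c\<in>C. scale (f (T c)) (T c)) = 0"
      using sum0 by (simp add: sum.union_disjoint[OF BW(4) finite_imageI[OF C(2)] disj] sum.reindex[OF inj])
    let ?s = "\<Sum>c\<in>C. scale (f (T c)) c"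
    have "T ?s = - (\<Sum>x\<in>BW. scale (f x) x)"
      using split by (simp add: T_sum T_scale eq_neg_iff_add_eq_0 add.commute)
    also have "\<dots> \<in> W" using BW(1) W(1)
      by (intro subspace_neg subspace_sum subspace_scale) auto
    finally have "?s \<in> ?K" using C(1) V(1) by (auto intro!: subspace_sum subspace_scale)
    then have "?s \<in> span BK" using BK(3) by blast
    then obtain g where g: "?s = (\<Sum>x\<in>BK. scale (g x) x)" unfolding span_finite[OF BK(4)] by blast
    \<comment> \<open>The combination of \<open>C\<close> lies in the kernel, so moving its expansion in \<open>BK\<close> to the other side gives a relation on the basis \<open>BV\<close>.\<close>
    define k where "k y = (if y \<in> BK then - g y else f (T y))" for y
    have "(\<Sum>y\<in>BV. scale (k y) y) = (\<Sum>y\<in>BK. scale (k y) y) + (\<Sum>y\<in>C. scale (k y) y)"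
      unfolding C(4) using C BK(4) by (intro sum.union_disjoint) auto
    also have "(\<Sum>y\<in>BK. scale (k y) y) = - ?s"
      unfolding g by (simp add: k_def sum_negf)
    also have "(\<Sum>y\<in>C. scale (k y) y) = ?s"
      using C(3) by (intro sum.cong) (auto simp: k_def)
    finally have "(\<Sum>y\<in>BV. scale (k y) y) = 0" by simp
    then have "k y = 0" if "y \<in> BV" for y
      using independentD[OF BV(3,5) subset_refl] that by blast
    then have fC: "f (T c) = 0" if "c \<in> C" for c
      using that C(3,4) unfolding k_def by (metis IntI Un_iff empty_iff)
    then have "(\<Sum>x\<in>BW. scale (f x) x) = 0" using split by simp
    then have "f y = 0" if "y \<in> BW" for y
      using independentD[OF BW(2,4) subset_refl] that by blast
    then show "f x = 0" using x fC by blast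
  qed
  have sub: "BW \<union> T ` C \<subseteq> ?S"
  proof
    fix y assume "y \<in> BW \<union> T ` C"
    then consider "y \<in> BW" | c where "c \<in> C" "y = T c" by blast
    then show "y \<in> ?S"
    proof cases
      case 1
      then have "y = y + T 0" "y \<in> W" "0 \<in> V" using BW(1) subspace_0[OF V(1)] by (auto simp: T0)
      then show ?thesis by blast
    next
      case 2
      then have "y = 0 + T c" "0 \<in> W" "c \<in> V" using C(1) subspace_0[OF W(1)] by auto
      then show ?thesis by blast
    qed
  qed
  have "?S \<subseteq> span (BW \<union> T ` C)"
  proof clarify
    fix w v assume w: "w \<in> W" and v: "v \<in> V"
    from v BV(4) have "v \<in> span BV" by blast
    then obtain g where "v = (\<Sum>x\<in>BV. scale (g x) x)" unfolding span_finite[OF BV(5)] by blast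
    then have "T v = (\<Sum>x\<in>BK. scale (g x) (T x)) + (\<Sum>x\<in>C. scale (g x) (T x))"
      using C BK(4) by (simp add: T_sum T_scale T_add sum.union_disjoint Int_commute)
    moreover have "(\<Sum>x\<in>BK. scale (g x) (T x)) \<in> W" using BK(1) W(1)
      by (intro subspace_sum subspace_scale) auto
    moreover have "W \<subseteq> span (BW \<union> T ` C)" using BW(3) span_mono[of BW "BW \<union> T ` C"] by blast
    moreover have "(\<Sum>x\<in>C. scale (g x) (T x)) \<in> span (BW \<union> T ` C)"
      by (intro span_sum span_scale span_base) auto
    ultimately show "w + T v \<in> span (BW \<union> T ` C)" using w by (auto intro!: span_add)
  qed
  then have "card (BW \<union> T ` C) = dim ?S" using basis_card_eq_dim[OF sub] indep by blast
  then have "dim ?S = card BW + card C"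
    using disj BW(4) C(2) inj by (simp add: card_Un_disjoint card_image)
  moreover have "card BV = card BK + card C" using C BK(4) by (simp add: card_Un_disjoint Int_commute)
  ultimately show ?thesis using BK(5) BV(6) BW(5) by simp
qed

end

section \<open>Power series with nonnegative coefficients\<close>

definition fps_nonneg :: "int fps \<Rightarrow> bool" where
  "fps_nonneg F \<longleftrightarrow> (\<forall>k. fps_nth F k \<ge> 0)"

lemma fps_nonneg_add: "fps_nonneg F \<Longrightarrow> fps_nonneg G \<Longrightarrow> fps_nonneg (F + G)"
  by (simp add: fps_nonneg_def)

lemma fps_nonneg_mult: "fps_nonneg F \<Longrightarrow> fps_nonneg G \<Longrightarrow> fps_nonneg (F * G)"
  by (auto simp: fps_nonneg_def fps_mult_nth intro!: sum_nonneg)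

lemma fps_nonneg_add_eq_0:
  assumes "fps_nonneg F" "fps_nonneg G" "F + G = 0" shows "F = 0 \<and> G = 0"
proof -
  have "fps_nth F k = 0 \<and> fps_nth G k = 0" for k
    using assms arg_cong[OF assms(3), of "\<lambda>H. fps_nth H k"] unfolding fps_nonneg_def
    by (metis add_nonneg_eq_0_iff fps_add_nth fps_zero_nth)
  then show ?thesis by (simp add: fps_eq_iff)
qed

lemma one_minus_fps_X_power_nth:
  "fps_nth ((1 - fps_X ^ a) * (F :: int fps)) k = fps_nth F k - (if k < a then 0 else fps_nth F (k - a))"
proof -
  have "(1 - fps_X ^ a) * F = F - fps_X ^ a * F" by (simp add: algebra_simps)
  then show ?thesis by (simp add: fps_X_power_mult_nth)
qed

text \<open>The inverse of \<open>1 - fps_X ^ a\<close>, written out so that its nonnegativity is visible.\<close>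

definition fps_geometric :: "nat \<Rightarrow> int fps" where
  "fps_geometric a = Abs_fps (\<lambda>k. if a dvd k then 1 else 0)"

lemma fps_geometric_nonneg: "fps_nonneg (fps_geometric a)"
  by (simp add: fps_nonneg_def fps_geometric_def)

lemma fps_geometric_prod_nonneg: "fps_nonneg (\<Prod>i\<in>F. fps_geometric (d i))"
  by (induction F rule: infinite_finite_induct)
    (auto simp: fps_geometric_nonneg intro: fps_nonneg_mult, auto simp: fps_nonneg_def)

lemma fps_geometric_inverse:
  assumes "a > 0" shows "(1 - fps_X ^ a) * fps_geometric a = 1"
proof (rule fps_ext)
  fix k
  show "fps_nth ((1 - fps_X ^ a) * fps_geometric a) k = fps_nth 1 k"
    using assms
    by (auto simp: one_minus_fps_X_power_nth fps_geometric_def dvd_minus_self dest: dvd_imp_le)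
qed

lemma one_minus_fps_X_power_neq_0: "a > 0 \<Longrightarrow> 1 - fps_X ^ a \<noteq> (0 :: int fps)"
  by (metis fps_geometric_inverse mult_zero_left zero_neq_one)

section \<open>Ideals and radicals\<close>

definition is_ideal :: "'a::comm_ring_1 set \<Rightarrow> bool" where
  "is_ideal A \<longleftrightarrow> 0 \<in> A \<and> (\<forall>x\<in>A. \<forall>y\<in>A. x + y \<in> A) \<and> (\<forall>x\<in>A. \<forall>r. r * x \<in> A)"

lemma is_idealD:
  assumes "is_ideal A"
  shows "0 \<in> A" "\<And>x y. x \<in> A \<Longrightarrow> y \<in> A \<Longrightarrow> x + y \<in> A" "\<And>x r. x \<in> A \<Longrightarrow> r * x \<in> A"
    "\<And>x r. x \<in> A \<Longrightarrow> x * r \<in> A" "\<And>x. x \<in> A \<Longrightarrow> - x \<in> A" "\<And>x y. x \<in> A \<Longrightarrow> y \<in> A \<Longrightarrow> x - y \<in> A"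
proof -
  show *: "0 \<in> A" "\<And>x y. x \<in> A \<Longrightarrow> y \<in> A \<Longrightarrow> x + y \<in> A" "\<And>x r. x \<in> A \<Longrightarrow> r * x \<in> A"
    using assms unfolding is_ideal_def by auto
  show "\<And>x r. x \<in> A \<Longrightarrow> x * r \<in> A" using *(3) by (simp add: mult.commute)
  show neg: "- x \<in> A" if "x \<in> A" for x using *(3)[OF that, of "-1"] by simp
  show "x - y \<in> A" if "x \<in> A" "y \<in> A" for x y using *(2)[OF that(1) neg[OF that(2)]] by simp
qed

lemma is_ideal_sum: "is_ideal A \<Longrightarrow> (\<And>i. i \<in> S \<Longrightarrow> f i \<in> A) \<Longrightarrow> sum f S \<in> A"
  by (induction S rule: infinite_finite_induct) (auto intro: is_idealD)

lemma ideal_cong_mult: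
  assumes "is_ideal A" "x - y \<in> A" "x' - y' \<in> A" shows "x * x' - y * y' \<in> A"
proof -
  have "x * x' - y * y' = (x - y) * x' + y * (x' - y')" by (simp add: algebra_simps)
  then show ?thesis using assms by (simp add: is_idealD)
qed

lemma ideal_cong_power: "is_ideal A \<Longrightarrow> x - y \<in> A \<Longrightarrow> x ^ k - y ^ k \<in> A"
  by (induction k) (auto intro: ideal_cong_mult is_idealD)

lemma ideal_cong_prod:
  "is_ideal A \<Longrightarrow> (\<And>i. i \<in> S \<Longrightarrow> f i - g i \<in> A) \<Longrightarrow> prod f S - prod g S \<in> A"
  by (induction S rule: infinite_finite_induct) (auto intro: ideal_cong_mult is_idealD)

definition ideal_gen :: "('i \<Rightarrow> 'a::comm_ring_1) \<Rightarrow> 'i set \<Rightarrow> 'a set" where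
  "ideal_gen \<phi> F = {\<Sum>i\<in>F. p i * \<phi> i | p. True}"

lemma is_ideal_ideal_gen: "is_ideal (ideal_gen \<phi> F)"
  unfolding is_ideal_def
proof (intro conjI ballI allI)
  show "0 \<in> ideal_gen \<phi> F" unfolding ideal_gen_def by (intro CollectI exI[of _ "\<lambda>_. 0"]) simp
  fix x assume "x \<in> ideal_gen \<phi> F"
  then obtain p where p: "x = (\<Sum>i\<in>F. p i * \<phi> i)" unfolding ideal_gen_def by blast
  {
    fix y assume "y \<in> ideal_gen \<phi> F"
    then obtain q where "y = (\<Sum>i\<in>F. q i * \<phi> i)" unfolding ideal_gen_def by blast
    then show "x + y \<in> ideal_gen \<phi> F"
      unfolding ideal_gen_def p
      by (intro CollectI exI[of _ "\<lambda>i. p i + q i"]) (simp add: sum.distrib distrib_right)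
  }
  fix r
  show "r * x \<in> ideal_gen \<phi> F"
    unfolding ideal_gen_def p
    by (intro CollectI exI[of _ "\<lambda>i. r * p i"]) (simp add: sum_distrib_left mult.assoc)
qed

lemma ideal_gen_base:
  assumes "finite F" "i \<in> F" shows "\<phi> i \<in> ideal_gen \<phi> F"
proof -
  have "(\<Sum>j\<in>F. of_bool (j = i) * \<phi> j) = (\<Sum>j\<in>F. if j = i then \<phi> j else 0)"
    by (rule sum.cong) auto
  also have "\<dots> = \<phi> i" using assms by simp
  finally show ?thesis unfolding ideal_gen_def
    by (intro CollectI exI[of _ "\<lambda>j. of_bool (j = i)"]) simp
qed

lemma ideal_gen_subset:
  assumes "is_ideal A" "\<And>i. i \<in> F \<Longrightarrow> \<phi> i \<in> A" shows "ideal_gen \<phi> F \<subseteq> A"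
  unfolding ideal_gen_def using assms by (auto intro!: is_ideal_sum is_idealD(3))

definition ideal_plus :: "'a::comm_ring_1 set \<Rightarrow> 'a set \<Rightarrow> 'a set" where
  "ideal_plus A B = {x + y | x y. x \<in> A \<and> y \<in> B}"

lemma is_ideal_plus: assumes "is_ideal A" "is_ideal B" shows "is_ideal (ideal_plus A B)"
  unfolding is_ideal_def
proof (intro conjI ballI allI)
  show "0 \<in> ideal_plus A B" unfolding ideal_plus_def using assms is_idealD(1) by force
  fix x assume "x \<in> ideal_plus A B"
  then obtain u v where x: "x = u + v" "u \<in> A" "v \<in> B" unfolding ideal_plus_def by blast
  {
    fix y assume "y \<in> ideal_plus A B"
    then obtain u' v' where y: "y = u' + v'" "u' \<in> A" "v' \<in> B" unfolding ideal_plus_def by blast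
    have "x + y = (u + u') + (v + v')" using x y by simp
    then show "x + y \<in> ideal_plus A B"
      unfolding ideal_plus_def using x y assms by (blast intro: is_idealD)
  }
  fix r
  have "r * x = r * u + r * v" using x by (simp add: algebra_simps)
  then show "r * x \<in> ideal_plus A B"
    unfolding ideal_plus_def using x assms by (blast intro: is_idealD)
qed

lemma ideal_plus_left: "is_ideal B \<Longrightarrow> x \<in> A \<Longrightarrow> x \<in> ideal_plus A B"
  unfolding ideal_plus_def using is_idealD(1) by force

lemma ideal_plus_right: "is_ideal A \<Longrightarrow> x \<in> B \<Longrightarrow> x \<in> ideal_plus A B"
  unfolding ideal_plus_def using is_idealD(1) by force

definition ideal_radical :: "'a::comm_ring_1 set \<Rightarrow> 'a set" where
  "ideal_radical A = {x. \<exists>N. x ^ N \<in> A}"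

lemma subset_ideal_radical: "A \<subseteq> ideal_radical A"
  unfolding ideal_radical_def by (auto intro: exI[of _ 1])

lemma ideal_radical_mono: "A \<subseteq> B \<Longrightarrow> ideal_radical A \<subseteq> ideal_radical B"
  unfolding ideal_radical_def by blast

lemma power_in_ideal_radical: "is_ideal A \<Longrightarrow> x ^ k \<in> ideal_radical A \<Longrightarrow> x \<in> ideal_radical A"
  unfolding ideal_radical_def by (auto simp flip: power_mult)

lemma is_ideal_ideal_radical: assumes A: "is_ideal A" shows "is_ideal (ideal_radical A)"
  unfolding is_ideal_def
proof (intro conjI ballI allI)
  show "0 \<in> ideal_radical A" using subset_ideal_radical is_idealD(1)[OF A] by blast
  fix x assume "x \<in> ideal_radical A"
  then obtain N where N: "x ^ N \<in> A" unfolding ideal_radical_def by blast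
  have big: "z ^ k \<in> A" if "z ^ K \<in> A" "K \<le> k" for z k K
  proof -
    have "z ^ k = z ^ (k - K) * z ^ K" using that(2) by (simp flip: power_add)
    then show ?thesis using is_idealD(3)[OF A that(1)] by simp
  qed
  {
    fix y assume "y \<in> ideal_radical A"
    then obtain M where M: "y ^ M \<in> A" unfolding ideal_radical_def by blast
    have "(x + y) ^ (N + M) = (\<Sum>k\<le>N + M. of_nat (N + M choose k) * x ^ k * y ^ (N + M - k))"
      by (rule binomial_ring)
    also have "\<dots> \<in> A"
    proof (rule is_ideal_sum[OF A])
      fix k assume k: "k \<in> {..N + M}"
      show "of_nat (N + M choose k) * x ^ k * y ^ (N + M - k) \<in> A"
      proof (cases "N \<le> k")
        case True
        then show ?thesis using big[OF N True] by (auto intro: is_idealD[OF A])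
      next
        case False
        then have "M \<le> N + M - k" by simp
        then show ?thesis using big[OF M] by (auto intro: is_idealD[OF A])
      qed
    qed
    finally show "x + y \<in> ideal_radical A" unfolding ideal_radical_def by blast
  }
  fix r
  have "(r * x) ^ N \<in> A" using N by (simp add: power_mult_distrib is_idealD(3)[OF A])
  then show "r * x \<in> ideal_radical A" unfolding ideal_radical_def by blast
qed

text \<open>The hypothesis says that \<open>A\<close> has no zero with exactly the coordinates in \<open>I\<close> different from
  \<open>0\<close>; the conclusion says that \<open>0\<close> is the only zero. Geometrically every point lies in some stratum.
  The algebraic proof shows by induction, from large to small \<open>I\<close>, that the product \<open>y\<close> of the
  \<open>x i\<close> with \<open>i \<in> I\<close> is in the radical of \<open>A\<close>: a power of \<open>y\<close> is a combination of the other variables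
  modulo \<open>A\<close>, and multiplying by \<open>y\<close> once more turns each variable \<open>x j\<close> into \<open>x j * y\<close>, which belongs to the
  larger index set \<open>insert j I\<close>.\<close>

lemma variables_in_ideal_radical:
  fixes x :: "'i \<Rightarrow> 'a::comm_ring_1"
  assumes A: "is_ideal A" and "finite V"
    and strata: "\<And>I. I \<subseteq> V \<Longrightarrow> I \<noteq> {} \<Longrightarrow> (\<Prod>i\<in>I. x i) \<in> ideal_radical (ideal_plus A (ideal_gen x (V - I)))"
    and "i \<in> V"
  shows "x i \<in> ideal_radical A"
proof -
  note R = is_ideal_ideal_radical[OF A]
  have "(\<Prod>i\<in>I. x i) \<in> ideal_radical A" if "I \<subseteq> V" "I \<noteq> {}" for I
    using that
  proof (induction "card (V - I)" arbitrary: I rule: less_induct)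
    case less
    let ?y = "\<Prod>i\<in>I. x i"
    have finI: "finite I" using less.prems(1) \<open>finite V\<close> finite_subset by blast
    obtain N where "?y ^ N \<in> ideal_plus A (ideal_gen x (V - I))"
      using strata[OF less.prems] unfolding ideal_radical_def by blast
    then obtain u p where up: "u \<in> A" "?y ^ N = u + (\<Sum>j\<in>V - I. p j * x j)"
      unfolding ideal_plus_def ideal_gen_def by blast
    have "?y ^ Suc N = ?y * u + (\<Sum>j\<in>V - I. p j * (x j * ?y))"
      by (simp add: up(2) distrib_left sum_distrib_left mult_ac)
    also have "\<dots> \<in> ideal_radical A"
    proof (rule is_idealD(2)[OF R])
      show "?y * u \<in> ideal_radical A" using up(1) subset_ideal_radical is_idealD(3)[OF R] by blast
      have "x j * ?y \<in> ideal_radical A" if j: "j \<in> V - I" for j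
      proof -
        have "V - insert j I \<subset> V - I" using j by blast
        then have "card (V - insert j I) < card (V - I)" using \<open>finite V\<close> by (simp add: psubset_card_mono)
        then have "(\<Prod>i\<in>insert j I. x i) \<in> ideal_radical A" using less.hyps[of "insert j I"] j less.prems by blast
        then show ?thesis using j finI by simp
      qed
      then show "(\<Sum>j\<in>V - I. p j * (x j * ?y)) \<in> ideal_radical A"
        using is_ideal_sum[OF R] is_idealD(3)[OF R] by meson
    qed
    finally show ?case by (rule power_in_ideal_radical[OF A])
  qed
  from this[of "{i}"] \<open>i \<in> V\<close> show ?thesis by simp
qed

text \<open>Modulo \<open>A\<close>, the relation may be evaluated at \<open>\<gamma> j * m j\<close> in place of \<open>r j\<close>. The complementary
  exponents \<open>D - u j\<close> make all its terms multiples of one and the same monomial in the \<open>m j\<close>,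
  which is left with the value of the relation at \<open>\<gamma>\<close> as coefficient.\<close>

lemma relation_gives_monomial_in_ideal:
  fixes r m \<gamma> :: "'j \<Rightarrow> 'a::comm_ring_1"
  assumes A: "is_ideal A" and cong: "\<And>j. j \<in> J \<Longrightarrow> r j - \<gamma> j * m j \<in> A"
    and rel: "(\<Sum>u\<in>U. h u * (\<Prod>j\<in>J. r j ^ u j * m j ^ (D - u j))) = 0"
    and U: "\<And>u j. u \<in> U \<Longrightarrow> j \<in> J \<Longrightarrow> u j \<le> D"
  shows "(\<Sum>u\<in>U. h u * (\<Prod>j\<in>J. \<gamma> j ^ u j)) * (\<Prod>j\<in>J. m j ^ D) \<in> A"
proof -
  have "(\<Prod>j\<in>J. \<gamma> j ^ u j) * (\<Prod>j\<in>J. m j ^ D) = (\<Prod>j\<in>J. (\<gamma> j * m j) ^ u j * m j ^ (D - u j))"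
    if "u \<in> U" for u
  proof -
    have "m j ^ D = m j ^ u j * m j ^ (D - u j)" if "j \<in> J" for j
      using U[OF \<open>u \<in> U\<close> that] by (simp flip: power_add)
    then have "(\<Prod>j\<in>J. m j ^ D) = (\<Prod>j\<in>J. m j ^ u j * m j ^ (D - u j))" by (intro prod.cong) auto
    then show ?thesis by (simp add: prod.distrib power_mult_distrib mult_ac)
  qed
  then have "(\<Sum>u\<in>U. h u * (\<Prod>j\<in>J. \<gamma> j ^ u j)) * (\<Prod>j\<in>J. m j ^ D)
      = (\<Sum>u\<in>U. h u * (\<Prod>j\<in>J. (\<gamma> j * m j) ^ u j * m j ^ (D - u j)))"
    by (simp add: sum_distrib_right mult.assoc)
  moreover have "(\<Sum>u\<in>U. h u * ((\<Prod>j\<in>J. r j ^ u j * m j ^ (D - u j))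
        - (\<Prod>j\<in>J. (\<gamma> j * m j) ^ u j * m j ^ (D - u j)))) \<in> A"
    by (intro is_ideal_sum[OF A] is_idealD(3)[OF A] ideal_cong_prod[OF A] ideal_cong_mult[OF A]
        ideal_cong_power[OF A] cong) (simp_all add: is_idealD(1)[OF A])
  ultimately have "- ((\<Sum>u\<in>U. h u * (\<Prod>j\<in>J. \<gamma> j ^ u j)) * (\<Prod>j\<in>J. m j ^ D)) \<in> A"
    using rel by (simp add: right_diff_distrib sum_subtractf)
  then show ?thesis using is_idealD(5)[OF A] by fastforce
qed

section \<open>Weighted-homogeneous polynomials\<close>

abbreviation (input) lookup :: "('a \<Rightarrow>\<^sub>0 'b::zero) \<Rightarrow> 'a \<Rightarrow> 'b"
  where "lookup \<equiv> Poly_Mapping.lookup"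

abbreviation (input) keys :: "('a \<Rightarrow>\<^sub>0 'b::zero) \<Rightarrow> 'a set"
  where "keys \<equiv> Poly_Mapping.keys"

type_synonym 'v mpoly = "('v \<Rightarrow>\<^sub>0 nat) \<Rightarrow>\<^sub>0 rat"

text \<open>Scalars act through constant polynomials, so that scalar multiplication is a case of ring
  multiplication and multiplication maps are linear by the ring axioms.\<close>

interpretation mp: vector_space "\<lambda>c p. Poly_Mapping.single 0 c * p :: 'm::comm_monoid_add \<Rightarrow>\<^sub>0 'a::field"
  by unfold_locales
    (simp_all add: distrib_left distrib_right single_add mult_single flip: mult.assoc)

lemma in_span_singles:
  fixes p :: "'m::comm_monoid_add \<Rightarrow>\<^sub>0 'a::field"
  assumes "keys p \<subseteq> M"
  shows "p \<in> mp.span ((\<lambda>m. Poly_Mapping.single m 1) ` M)"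
proof -
  have "p = (\<Sum>m\<in>keys p. Poly_Mapping.single 0 (lookup p m) * Poly_Mapping.single m 1)"
    by (rule poly_mapping_eqI) (simp add: lookup_sum mult_single lookup_single when_def in_keys_iff)
  also have "\<dots> \<in> mp.span ((\<lambda>m. Poly_Mapping.single m 1) ` M)"
    using assms by (intro mp.span_sum mp.span_scale mp.span_base) auto
  finally show ?thesis .
qed

lemma independent_singles:
  fixes M :: "'m::comm_monoid_add set"
  assumes "finite M"
  shows "mp.independent ((\<lambda>m. Poly_Mapping.single m (1 :: 'a::field)) ` M)"
proof (rule mp.independent_if_scalars_zero)
  let ?s = "\<lambda>m. Poly_Mapping.single m (1 :: 'a)"
  have inj: "inj_on ?s M" by (rule inj_onI) (metis keys_single one_neq_zero singleton_inject)
  show "finite (?s ` M)" using assms by simp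
  fix f :: "('m \<Rightarrow>\<^sub>0 'a) \<Rightarrow> 'a" and x
  assume "(\<Sum>x\<in>?s ` M. Poly_Mapping.single 0 (f x) * x) = 0" and "x \<in> ?s ` M"
  then obtain m where m: "x = ?s m" "m \<in> M"
    and "(\<Sum>m\<in>M. Poly_Mapping.single 0 (f (?s m)) * ?s m) = 0"
    unfolding sum.reindex[OF inj] by auto
  from arg_cong[OF this(3), of "\<lambda>p. lookup p m"] have "(\<Sum>l\<in>M. if l = m then f (?s l) else 0) = 0"
    by (simp add: lookup_sum mult_single lookup_single when_def)
  then show "f x = 0" using m assms by simp
qed

locale weighted_variables =
  fixes V :: "'v set" and b :: "'v \<Rightarrow> nat"
  assumes finite_V: "finite V" and weight_pos: "i \<in> V \<Longrightarrow> b i > 0"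
begin

definition wt :: "('v \<Rightarrow>\<^sub>0 nat) \<Rightarrow> nat" where
  "wt m = (\<Sum>i\<in>V. lookup m i * b i)"

text \<open>Degrees are integers because degrees get shifted down: pieces of negative degree are
  empty, and no case distinction is needed.\<close>

definition mons :: "'v set \<Rightarrow> int \<Rightarrow> ('v \<Rightarrow>\<^sub>0 nat) set" where
  "mons W k = {m. keys m \<subseteq> W \<and> int (wt m) = k}"

definition homog :: "'v set \<Rightarrow> int \<Rightarrow> 'v mpoly set" where
  "homog W k = {p. keys p \<subseteq> mons W k}"

lemma wt_add: "wt (m + m') = wt m + wt m'"
  by (simp add: wt_def lookup_add sum.distrib distrib_right)

lemma keys_plus_nat: "keys (m + m' :: 'v \<Rightarrow>\<^sub>0 nat) = keys m \<union> keys m'"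
  by (auto simp: in_keys_iff lookup_add)

lemma mons_add: "m \<in> mons W k \<Longrightarrow> m' \<in> mons W l \<Longrightarrow> m + m' \<in> mons W (k + l)"
  by (auto simp: mons_def wt_add keys_plus_nat)

lemma mons_cancel: "m' \<in> mons W l \<Longrightarrow> m + m' \<in> mons W k \<Longrightarrow> m \<in> mons W (k - l)"
  by (auto simp: mons_def wt_add keys_plus_nat)

lemma lookup_le_wt: assumes "i \<in> V" shows "lookup m i \<le> wt m"
proof -
  have "lookup m i \<le> lookup m i * b i" using weight_pos[OF assms] by simp
  also have "\<dots> \<le> wt m" unfolding wt_def using finite_V assms by (intro member_le_sum) auto
  finally show ?thesis .
qed

lemma wt_single: "i \<in> V \<Longrightarrow> wt (Poly_Mapping.single i 1) = b i"
proof -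
  assume "i \<in> V"
  moreover have "wt (Poly_Mapping.single i 1) = (\<Sum>j\<in>V. if j = i then b j else 0)"
    unfolding wt_def by (rule sum.cong) (auto simp: lookup_single)
  ultimately show ?thesis using finite_V by simp
qed

lemma wt_eq_sum: assumes "keys m \<subseteq> W" "W \<subseteq> V" shows "wt m = (\<Sum>i\<in>W. lookup m i * b i)"
  unfolding wt_def
  by (rule sum.mono_neutral_right) (use assms finite_V in \<open>auto simp: in_keys_iff\<close>)

text \<open>The exponent of \<open>i\<close> is determined by the weight and the other exponents.
  The bound thus has one factor less than there are variables, and \<open>exists_relation\<close> depends on
  this gain.\<close>

lemma finite_card_mons:
  assumes W: "W \<subseteq> V" "i \<in> W"
  shows "finite (mons W k)" "card (mons W k) \<le> (nat k + 1) ^ (card W - 1)"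
proof -
  let ?f = "\<lambda>m. restrict (lookup m) (W - {i})" and ?T = "PiE (W - {i}) (\<lambda>_. {..nat k})"
  have finW: "finite W" using W(1) finite_V finite_subset by blast
  have inj: "inj_on ?f (mons W k)"
  proof (rule inj_onI)
    fix m m' assume m: "m \<in> mons W k" "m' \<in> mons W k" "?f m = ?f m'"
    then have eq: "lookup m j = lookup m' j" if "j \<in> W - {i}" for j by (metis restrict_apply' that)
    have split: "wt l = lookup l i * b i + (\<Sum>j\<in>W - {i}. lookup l j * b j)" if "l \<in> mons W k" for l
      using that W finW by (subst wt_eq_sum[of l W]) (auto simp: mons_def sum.remove)
    have "wt m = wt m'" using m(1,2) unfolding mons_def by simp
    then have "lookup m i * b i = lookup m' i * b i" using split[OF m(1)] split[OF m(2)] eq by simp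
    then have "lookup m i = lookup m' i" using weight_pos[of i] W by auto
    then have "lookup m j = lookup m' j" if "j \<in> W" for j using eq that by blast
    moreover have "lookup m j = 0 \<and> lookup m' j = 0" if "j \<notin> W" for j
      using m(1,2) that unfolding mons_def by (auto simp: in_keys_iff)
    ultimately show "m = m'" by (intro poly_mapping_eqI) metis
  qed
  have sub: "?f ` mons W k \<subseteq> ?T"
  proof
    fix g assume "g \<in> ?f ` mons W k"
    then obtain m where m: "m \<in> mons W k" "g = ?f m" by blast
    have "lookup m j \<le> nat k" if "j \<in> W" for j
      using lookup_le_wt[of j m] that W m(1) unfolding mons_def by auto
    then show "g \<in> ?T" using m(2) by auto
  qed
  have finT: "finite ?T" using finW by (intro finite_PiE) auto
  show "finite (mons W k)" using inj sub finT by (meson finite_imageD finite_subset)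
  have "card (mons W k) \<le> card ?T" using card_inj_on_le[OF inj sub finT] .
  also have "\<dots> = (nat k + 1) ^ (card W - 1)" using finW W(2) by (simp add: card_PiE)
  finally show "card (mons W k) \<le> (nat k + 1) ^ (card W - 1)" .
qed

lemma finite_mons: assumes "W \<subseteq> V" shows "finite (mons W k)"
proof (cases "W = {}")
  case True
  then have "mons W k \<subseteq> {0}" unfolding mons_def by auto
  then show ?thesis using finite_subset by blast
next
  case False then show ?thesis using finite_card_mons(1) assms by blast
qed

lemma homog_0 [simp]: "0 \<in> homog W k"
  by (simp add: homog_def)

lemma homog_add: "p \<in> homog W k \<Longrightarrow> q \<in> homog W k \<Longrightarrow> p + q \<in> homog W k"
  unfolding homog_def using keys_add[of p q] by auto

lemma homog_mult: assumes "p \<in> homog W k" "q \<in> homog W l" shows "p * q \<in> homog W (k + l)"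
  unfolding homog_def
proof (rule CollectI, rule subsetI)
  fix m assume "m \<in> keys (p * q)"
  then obtain m1 m2 where "m = m1 + m2" "m1 \<in> keys p" "m2 \<in> keys q" using keys_mult[of p q] by blast
  then show "m \<in> mons W (k + l)" using assms unfolding homog_def by (auto intro: mons_add)
qed

lemma homog_const: "Poly_Mapping.single 0 c \<in> homog W 0"
  by (simp add: homog_def mons_def wt_def)

lemma homog_1: "1 \<in> homog W 0"
  using homog_const[of 1 W] by simp

lemma homog_scale: "p \<in> homog W k \<Longrightarrow> Poly_Mapping.single 0 c * p \<in> homog W k"
  using homog_mult[OF homog_const] by fastforce

lemma homog_sum: "(\<And>i. i \<in> S \<Longrightarrow> f i \<in> homog W k) \<Longrightarrow> sum f S \<in> homog W k"
  by (induction S rule: infinite_finite_induct) (auto intro: homog_add)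

lemma homog_power: "p \<in> homog W k \<Longrightarrow> p ^ n \<in> homog W (int n * k)"
  by (induction n) (auto simp: homog_1 distrib_right intro: homog_mult)

lemma homog_prod: "(\<And>i. i \<in> S \<Longrightarrow> f i \<in> homog W (k i)) \<Longrightarrow> prod f S \<in> homog W (sum k S)"
  by (induction S rule: infinite_finite_induct) (auto simp: homog_1 intro: homog_mult)

lemma homog_negative: "k < 0 \<Longrightarrow> p \<in> homog W k \<Longrightarrow> p = 0"
  by (auto simp: homog_def mons_def)

lemma subspace_homog: "mp.subspace (homog W k)"
  by (auto simp: mp.subspace_def intro: homog_add homog_scale)

lemma homog_subset_span: "homog W k \<subseteq> mp.span ((\<lambda>m. Poly_Mapping.single m 1) ` mons W k)"
  by (auto simp: homog_def intro: in_span_singles)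

lemma dim_homog: assumes "W \<subseteq> V" shows "mp.dim (homog W k) = card (mons W k)"
proof -
  let ?s = "\<lambda>m. Poly_Mapping.single m 1 :: 'v mpoly"
  have "?s ` mons W k \<subseteq> homog W k" by (auto simp: homog_def)
  then have "card (?s ` mons W k) = mp.dim (homog W k)"
    using mp.basis_card_eq_dim[OF _ homog_subset_span independent_singles[OF finite_mons[OF assms]]] by simp
  moreover have "inj_on ?s (mons W k)" by (rule inj_onI) (metis keys_single one_neq_zero singleton_inject)
  ultimately show ?thesis by (simp add: card_image)
qed

definition hilbert_free :: "'v set \<Rightarrow> int fps" where
  "hilbert_free W = Abs_fps (\<lambda>k. int (card (mons W (int k))))"

text \<open>Monomials are split according to whether they are divisible by the variable \<open>i\<close>.\<close>

lemma card_mons_insert: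
  assumes "insert i W \<subseteq> V" "i \<notin> W"
  shows "card (mons (insert i W) k) = card (mons W k) + card (mons (insert i W) (k - int (b i)))"
proof -
  let ?x = "Poly_Mapping.single i 1 :: 'v \<Rightarrow>\<^sub>0 nat"
  have i: "i \<in> V" using assms(1) by simp
  have x: "?x \<in> mons (insert i W) (int (b i))" using wt_single[OF i] by (simp add: mons_def)
  have eq: "mons (insert i W) k = mons W k \<union> (\<lambda>m. m + ?x) ` mons (insert i W) (k - int (b i))"
  proof (intro equalityI subsetI)
    fix m assume m: "m \<in> mons (insert i W) k"
    show "m \<in> mons W k \<union> (\<lambda>m. m + ?x) ` mons (insert i W) (k - int (b i))"
    proof (cases "i \<in> keys m")
      case False then show ?thesis using m by (auto simp: mons_def)
    next
      case True
      then have "m = (m - ?x) + ?x"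
        by (intro poly_mapping_eqI) (auto simp: lookup_add lookup_minus lookup_single when_def in_keys_iff)
      then show ?thesis using mons_cancel[OF x, of "m - ?x" k] m by (metis UnI2 image_eqI)
    qed
  next
    fix m assume "m \<in> mons W k \<union> (\<lambda>m. m + ?x) ` mons (insert i W) (k - int (b i))"
    then show "m \<in> mons (insert i W) k"
      using mons_add[OF _ x, of _ "k - int (b i)"] by (auto simp: mons_def)
  qed
  have "mons W k \<inter> (\<lambda>m. m + ?x) ` mons (insert i W) (k - int (b i)) = {}"
    using assms(2) by (auto simp: mons_def keys_plus_nat)
  moreover have "inj_on (\<lambda>m. m + ?x) (mons (insert i W) (k - int (b i)))" by (simp add: inj_on_def)
  ultimately show ?thesis
    using finite_mons[of W k] finite_mons[OF assms(1)] assms(1) by (subst eq) (simp add: card_Un_disjoint card_image)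
qed

lemma hilbert_free_eq:
  assumes "W \<subseteq> V" shows "hilbert_free W * (\<Prod>i\<in>W. 1 - fps_X ^ b i) = 1"
proof -
  have "finite W" using assms finite_V finite_subset by blast
  then show ?thesis using assms
  proof (induction W rule: finite_induct)
    case empty
    have "mons {} k = (if k = 0 then {0} else {})" for k by (auto simp: mons_def wt_def)
    then show ?case by (intro fps_ext) (simp add: hilbert_free_def)
  next
    case (insert i W)
    have "(1 - fps_X ^ b i) * hilbert_free (insert i W) = hilbert_free W"
    proof (rule fps_ext)
      fix k
      have "mons (insert i W) (int k - int (b i)) = {}" if "k < b i" using that by (auto simp: mons_def)
      then show "fps_nth ((1 - fps_X ^ b i) * hilbert_free (insert i W)) k = fps_nth (hilbert_free W) k"
        using card_mons_insert[OF insert.prems insert.hyps(2), of "int k"]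
        by (auto simp: one_minus_fps_X_power_nth hilbert_free_def of_nat_diff)
    qed
    then show ?case using insert by (simp add: mult.assoc[symmetric] mult.commute)
  qed
qed

end

section \<open>Hilbert series and regular families of forms\<close>

locale homogeneous_forms = weighted_variables V b for V :: "'v set" and b :: "'v \<Rightarrow> nat" +
  fixes \<phi> :: "'i \<Rightarrow> 'v mpoly" and \<delta> :: "'i \<Rightarrow> nat" and Ix :: "'i set"
  assumes form_homog: "i \<in> Ix \<Longrightarrow> \<phi> i \<in> homog V (int (\<delta> i))"
    and degree_pos: "i \<in> Ix \<Longrightarrow> \<delta> i > 0"
begin

text \<open>The part of degree \<open>k\<close> of the ideal generated by \<open>F\<close>; see \<open>gr_ideal_of_ideal_gen\<close>.\<close>

definition gr_ideal :: "'i set \<Rightarrow> int \<Rightarrow> 'v mpoly set" where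
  "gr_ideal F k = {\<Sum>i\<in>F. p i * \<phi> i | p. \<forall>i\<in>F. p i \<in> homog V (k - int (\<delta> i))}"

text \<open>The Hilbert series of the quotient by the ideal generated by \<open>F\<close>.\<close>

definition hilbert :: "'i set \<Rightarrow> int fps" where
  "hilbert F = Abs_fps (\<lambda>k. int (mp.dim (homog V (int k))) - int (mp.dim (gr_ideal F (int k))))"

text \<open>The series of the kernel of multiplication by \<open>\<phi> f\<close> on the quotient by \<open>F\<close>. The kernel
  element \<open>v\<close> is recorded in the degree of \<open>\<phi> f * v\<close>.\<close>

definition excess :: "'i set \<Rightarrow> 'i \<Rightarrow> int fps" where
  "excess F f = Abs_fps (\<lambda>k.
     int (mp.dim {v \<in> homog V (int k - int (\<delta> f)). \<phi> f * v \<in> gr_ideal F (int k)})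
     - int (mp.dim (gr_ideal F (int k - int (\<delta> f)))))"

text \<open>The family \<open>F\<close> is a regular sequence, expressed by the Hilbert series that regular sequences
  have. Unlike the usual condition on successive nonzerodivisors, this does not refer to an
  order of the family, so any member may be exchanged.\<close>

definition regular :: "'i set \<Rightarrow> bool" where
  "regular F \<longleftrightarrow> hilbert F = hilbert {} * (\<Prod>i\<in>F. 1 - fps_X ^ \<delta> i)"

lemma gr_ideal_subset_homog: assumes "F \<subseteq> Ix" shows "gr_ideal F k \<subseteq> homog V k"
proof
  fix x assume "x \<in> gr_ideal F k"
  then obtain p where p: "x = (\<Sum>i\<in>F. p i * \<phi> i)" "\<forall>i\<in>F. p i \<in> homog V (k - int (\<delta> i))"
    unfolding gr_ideal_def by blast
  have "p i * \<phi> i \<in> homog V k" if "i \<in> F" for i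
    using homog_mult[OF bspec[OF p(2) that] form_homog[of i]] that assms by auto
  then show "x \<in> homog V k" unfolding p(1) by (rule homog_sum)
qed

lemma gr_ideal_mult:
  assumes "q \<in> homog V l" "x \<in> gr_ideal F k" shows "q * x \<in> gr_ideal F (k + l)"
proof -
  from assms obtain p where p: "x = (\<Sum>i\<in>F. p i * \<phi> i)" "\<forall>i\<in>F. p i \<in> homog V (k - int (\<delta> i))"
    unfolding gr_ideal_def by blast
  have "q * p i \<in> homog V (k + l - int (\<delta> i))" if "i \<in> F" for i
    using homog_mult[OF assms(1) bspec[OF p(2) that]] by (simp add: algebra_simps)
  then show ?thesis unfolding gr_ideal_def p(1)
    by (intro CollectI exI[of _ "\<lambda>i. q * p i"]) (simp add: sum_distrib_left mult.assoc)
qed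

lemma gr_ideal_add:
  assumes "x \<in> gr_ideal F k" "y \<in> gr_ideal F k" shows "x + y \<in> gr_ideal F k"
proof -
  from assms obtain p q where p: "x = (\<Sum>i\<in>F. p i * \<phi> i)" "\<forall>i\<in>F. p i \<in> homog V (k - int (\<delta> i))"
    and q: "y = (\<Sum>i\<in>F. q i * \<phi> i)" "\<forall>i\<in>F. q i \<in> homog V (k - int (\<delta> i))"
    unfolding gr_ideal_def by blast
  then show ?thesis unfolding gr_ideal_def
    by (intro CollectI exI[of _ "\<lambda>i. p i + q i"])
      (auto simp: sum.distrib distrib_right intro: homog_add)
qed

lemma gr_ideal_0: "0 \<in> gr_ideal F k"
  unfolding gr_ideal_def by (intro CollectI exI[of _ "\<lambda>_. 0"]) simp

lemma subspace_gr_ideal: "mp.subspace (gr_ideal F k)"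
  unfolding mp.subspace_def
  using gr_ideal_0 gr_ideal_add gr_ideal_mult[OF homog_const] by fastforce

lemma gr_ideal_insert:
  assumes "finite F" "f \<notin> F"
  shows "gr_ideal (insert f F) k = {w + \<phi> f * v | w v. w \<in> gr_ideal F k \<and> v \<in> homog V (k - int (\<delta> f))}"
proof (intro equalityI subsetI)
  fix x assume "x \<in> gr_ideal (insert f F) k"
  then obtain p where p: "x = (\<Sum>i\<in>insert f F. p i * \<phi> i)" "\<forall>i\<in>insert f F. p i \<in> homog V (k - int (\<delta> i))"
    unfolding gr_ideal_def by blast
  then have "x = (\<Sum>i\<in>F. p i * \<phi> i) + \<phi> f * p f"
    using assms by (simp add: add.commute mult.commute)
  moreover have "(\<Sum>i\<in>F. p i * \<phi> i) \<in> gr_ideal F k" unfolding gr_ideal_def using p(2) by blast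
  ultimately show "x \<in> {w + \<phi> f * v | w v. w \<in> gr_ideal F k \<and> v \<in> homog V (k - int (\<delta> f))}"
    using p(2) by blast
next
  fix x assume "x \<in> {w + \<phi> f * v | w v. w \<in> gr_ideal F k \<and> v \<in> homog V (k - int (\<delta> f))}"
  then obtain p v where x: "x = (\<Sum>i\<in>F. p i * \<phi> i) + \<phi> f * v" "v \<in> homog V (k - int (\<delta> f))"
    "\<forall>i\<in>F. p i \<in> homog V (k - int (\<delta> i))"
    unfolding gr_ideal_def by blast
  have "x = (\<Sum>i\<in>insert f F. (p(f := v)) i * \<phi> i)"
  proof -
    have "(\<Sum>i\<in>F. (p(f := v)) i * \<phi> i) = (\<Sum>i\<in>F. p i * \<phi> i)"
      using assms(2) by (intro sum.cong) auto
    then show ?thesis using assms x(1) by (simp add: add.commute mult.commute)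
  qed
  then show "x \<in> gr_ideal (insert f F) k"
    unfolding gr_ideal_def using x(2,3) by (intro CollectI exI[of _ "p(f := v)"]) simp
qed

lemma homogeneous_part:
  obtains q where "q \<in> homog V k" "keys (p - q) \<inter> mons V k = {}"
proof -
  let ?q = "\<Sum>m\<in>keys p \<inter> mons V k. Poly_Mapping.single m (lookup p m)"
  have look: "lookup ?q m = (if m \<in> mons V k then lookup p m else 0)" for m
    by (auto simp: lookup_sum lookup_single when_def in_keys_iff)
  have "?q \<in> homog V k" unfolding homog_def by (auto simp: in_keys_iff look split: if_splits)
  moreover have "keys (p - ?q) \<inter> mons V k = {}" by (auto simp: in_keys_iff lookup_minus look)
  ultimately show thesis using that by blast
qed

text \<open>Each coefficient of the combination may be replaced by its component of the right degree and
  in the right variables: what is cut off contributes no monomial of degree \<open>k\<close>.\<close>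

lemma gr_ideal_of_ideal_gen:
  assumes "F \<subseteq> Ix" "x \<in> ideal_gen \<phi> F" "x \<in> homog V k"
  shows "x \<in> gr_ideal F k"
proof -
  from assms(2) obtain p where p: "x = (\<Sum>i\<in>F. p i * \<phi> i)" unfolding ideal_gen_def by blast
  have "\<exists>q. q \<in> homog V (k - int (\<delta> i)) \<and> keys (p i - q) \<inter> mons V (k - int (\<delta> i)) = {}" for i
    using homogeneous_part by metis
  then obtain q where q: "\<And>i. q i \<in> homog V (k - int (\<delta> i))"
    "\<And>i. keys (p i - q i) \<inter> mons V (k - int (\<delta> i)) = {}" by metis
  let ?y = "\<Sum>i\<in>F. q i * \<phi> i" and ?z = "\<Sum>i\<in>F. (p i - q i) * \<phi> i"
  have y: "?y \<in> gr_ideal F k" unfolding gr_ideal_def using q(1) by blast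
  have "lookup ?z m = 0" if m: "m \<in> mons V k" for m
  proof -
    have "lookup ((p i - q i) * \<phi> i) m = 0" if i: "i \<in> F" for i
    proof (rule ccontr)
      assume "lookup ((p i - q i) * \<phi> i) m \<noteq> 0"
      then obtain m1 m2 where m12: "m = m1 + m2" "m1 \<in> keys (p i - q i)" "m2 \<in> keys (\<phi> i)"
        using keys_mult[of "p i - q i" "\<phi> i"] by (auto simp: in_keys_iff)
      have "m2 \<in> mons V (int (\<delta> i))" using form_homog[of i] i assms(1) m12(3) unfolding homog_def by blast
      then have "m1 \<in> mons V (k - int (\<delta> i))" using mons_cancel m m12(1) by blast
      then show False using q(2) m12(2) by blast
    qed
    then show ?thesis by (simp add: lookup_sum)
  qed
  moreover have xyz: "x = ?y + ?z" by (simp add: p sum.distrib[symmetric] algebra_simps)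
  moreover have "lookup ?z m = 0" if "m \<notin> mons V k" for m
  proof -
    have "keys x \<subseteq> mons V k" "keys ?y \<subseteq> mons V k"
      using assms(3) gr_ideal_subset_homog[OF assms(1)] y unfolding homog_def by blast+
    then have "lookup x m = 0" "lookup ?y m = 0" using that by (auto simp: in_keys_iff)
    then show ?thesis using arg_cong[OF xyz, of "\<lambda>p. lookup p m"] by (simp add: lookup_add)
  qed
  ultimately have "?z = 0" by (intro poly_mapping_eqI) (metis lookup_zero)
  then show ?thesis using y xyz by simp
qed

lemma homog_spanned: "homog V k \<subseteq> mp.span ((\<lambda>m. Poly_Mapping.single m 1) ` mons V k)"
  "finite ((\<lambda>m. Poly_Mapping.single m 1 :: 'v mpoly) ` mons V k)"
  using homog_subset_span finite_mons by auto

lemma hilbert_nonneg: "F \<subseteq> Ix \<Longrightarrow> fps_nonneg (hilbert F)"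
  unfolding fps_nonneg_def hilbert_def
  using mp.dim_subset_le[OF gr_ideal_subset_homog homog_spanned] by simp

lemma hilbert_empty: "hilbert {} = hilbert_free V"
proof -
  have "gr_ideal {} k = {0}" for k by (simp add: gr_ideal_def)
  then show ?thesis by (simp add: mp.dim_zero_subspace hilbert_def hilbert_free_def dim_homog)
qed

context
  fixes F f assumes fin: "finite F" and f: "f \<notin> F" and sub: "insert f F \<subseteq> Ix"
begin

lemma gr_ideal_subset_colon:
  "gr_ideal F (k - int (\<delta> f)) \<subseteq> {v \<in> homog V (k - int (\<delta> f)). \<phi> f * v \<in> gr_ideal F k}"
  using gr_ideal_mult[OF form_homog[of f]] gr_ideal_subset_homog[of F] sub by fastforce

lemma excess_nonneg: "fps_nonneg (excess F f)"
proof -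
  have "mp.dim (gr_ideal F (k - int (\<delta> f))) \<le> mp.dim {v \<in> homog V (k - int (\<delta> f)). \<phi> f * v \<in> gr_ideal F k}" for k
    by (rule mp.dim_subset_le[OF gr_ideal_subset_colon order_trans[OF _ homog_spanned(1)] homog_spanned(2)]) auto
  then show ?thesis by (simp add: fps_nonneg_def excess_def)
qed

text \<open>In every degree the ideal of \<open>F\<close> is contained in the space of elements that \<open>\<phi> f\<close> multiplies into
  it, so equality of dimensions is equality. Vanishing excess therefore means that \<open>\<phi> f\<close> is a
  nonzerodivisor modulo \<open>F\<close>.\<close>

lemma excess_eq_0_iff:
  "excess F f = 0 \<longleftrightarrow> (\<forall>l. \<forall>v\<in>homog V l. \<phi> f * v \<in> gr_ideal F (l + int (\<delta> f)) \<longrightarrow> v \<in> gr_ideal F l)"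
proof
  assume E: "excess F f = 0"
  show "\<forall>l. \<forall>v\<in>homog V l. \<phi> f * v \<in> gr_ideal F (l + int (\<delta> f)) \<longrightarrow> v \<in> gr_ideal F l"
  proof (intro allI ballI impI)
    fix l v assume v: "v \<in> homog V l" "\<phi> f * v \<in> gr_ideal F (l + int (\<delta> f))"
    show "v \<in> gr_ideal F l"
    proof (cases "l < 0")
      case True then show ?thesis using homog_negative v(1) gr_ideal_0 by blast
    next
      case False
      \<comment> \<open>The coefficient of the excess that sees kernel elements of degree \<open>l\<close>.\<close>
      define k where "k = nat (l + int (\<delta> f))"
      have k: "int k - int (\<delta> f) = l" "int k = l + int (\<delta> f)" using False by (auto simp: k_def)
      let ?K = "{v \<in> homog V l. \<phi> f * v \<in> gr_ideal F (int k)}"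
      have "mp.dim (gr_ideal F l) = mp.dim ?K"
        using arg_cong[OF E, of "\<lambda>H. fps_nth H k"] by (simp add: excess_def k(1))
      moreover have "?K \<subseteq> homog V l" by auto
      ultimately have "gr_ideal F l = ?K"
        using mp.subspace_eqI_dim[OF subspace_gr_ideal gr_ideal_subset_colon[of "int k", unfolded k(1)]
            order_trans[OF _ homog_spanned(1)[of l]] homog_spanned(2)] by simp
      then show ?thesis using v k(2) by simp
    qed
  qed
next
  assume inj: "\<forall>l. \<forall>v\<in>homog V l. \<phi> f * v \<in> gr_ideal F (l + int (\<delta> f)) \<longrightarrow> v \<in> gr_ideal F l"
  show "excess F f = 0"
  proof (rule fps_ext)
    fix k
    have "{v \<in> homog V (int k - int (\<delta> f)). \<phi> f * v \<in> gr_ideal F (int k)} = gr_ideal F (int k - int (\<delta> f))"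
      using gr_ideal_subset_colon[of "int k"] inj by fastforce
    then show "fps_nth (excess F f) k = fps_nth 0 k" by (simp add: excess_def)
  qed
qed

text \<open>The exact sequence of multiplication by \<open>\<phi> f\<close> on the quotient by \<open>F\<close>, in terms of dimensions.\<close>

lemma hilbert_insert:
  "hilbert (insert f F) = (1 - fps_X ^ \<delta> f) * hilbert F + excess F f"
proof (rule fps_ext)
  fix k
  have "mp.dim (gr_ideal (insert f F) (int k))
      + mp.dim {v \<in> homog V (int k - int (\<delta> f)). \<phi> f * v \<in> gr_ideal F (int k)}
      = mp.dim (gr_ideal F (int k)) + mp.dim (homog V (int k - int (\<delta> f)))"
    unfolding gr_ideal_insert[OF fin f]
  proof (rule mp.dim_sum_image[OF _ _ subspace_homog homog_spanned(1) subspace_gr_ideal _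
        homog_spanned(2) homog_spanned(2)])
    show "gr_ideal F (int k) \<subseteq> mp.span ((\<lambda>m. Poly_Mapping.single m 1) ` mons V (int k))"
      using gr_ideal_subset_homog[of F] sub homog_spanned(1) by blast
  qed (simp_all add: distrib_left mult.left_commute)
  moreover have "mp.dim (homog V l) = 0 \<and> mp.dim (gr_ideal F l) = 0" if "l < 0" for l
  proof -
    have "homog V l = {0}" using homog_negative[OF that] homog_0 by blast
    moreover have "gr_ideal F l = {0}"
      using gr_ideal_subset_homog[of F l] sub gr_ideal_0 calculation by blast
    ultimately show ?thesis by (simp add: mp.dim_zero_subspace)
  qed
  ultimately show "fps_nth (hilbert (insert f F)) k = fps_nth ((1 - fps_X ^ \<delta> f) * hilbert F + excess F f) k"
    by (auto simp: one_minus_fps_X_power_nth hilbert_def excess_def of_nat_diff)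
qed

end

lemma geometric_prod_inverse:
  assumes "F \<subseteq> Ix"
  shows "(\<Prod>i\<in>F. fps_geometric (\<delta> i)) * (\<Prod>i\<in>F. 1 - fps_X ^ \<delta> i) = 1"
proof -
  have "(\<Prod>i\<in>F. fps_geometric (\<delta> i) * (1 - fps_X ^ \<delta> i)) = (\<Prod>i\<in>F. 1)"
  proof (rule prod.cong[OF refl])
    fix i assume "i \<in> F"
    then show "fps_geometric (\<delta> i) * (1 - fps_X ^ \<delta> i) = 1"
      using fps_geometric_inverse[OF degree_pos, of i] assms by (metis mult.commute subsetD)
  qed
  then show ?thesis by (simp add: prod.distrib)
qed

text \<open>Normalised by the geometric series, the Hilbert series grows by a nonnegative amount with each
  form, and by nothing exactly when the form is a nonzerodivisor.\<close>

lemma geometric_hilbert_insert: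
  assumes "finite F" "f \<notin> F" "insert f F \<subseteq> Ix"
  shows "(\<Prod>i\<in>insert f F. fps_geometric (\<delta> i)) * hilbert (insert f F)
    = (\<Prod>i\<in>F. fps_geometric (\<delta> i)) * hilbert F + (\<Prod>i\<in>insert f F. fps_geometric (\<delta> i)) * excess F f"
proof -
  let ?g = "fps_geometric (\<delta> f)" and ?P = "\<Prod>i\<in>F. fps_geometric (\<delta> i)"
  have "?g * ?P * ((1 - fps_X ^ \<delta> f) * hilbert F) = ((1 - fps_X ^ \<delta> f) * ?g) * (?P * hilbert F)"
    by (simp only: mult_ac)
  also have "\<dots> = ?P * hilbert F"
    using fps_geometric_inverse[OF degree_pos, of f] assms(3) by simp
  finally show ?thesis
    using assms(1,2) unfolding hilbert_insert[OF assms] distrib_left by simp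
qed

lemma regular_iff:
  assumes "F \<subseteq> Ix"
  shows "regular F \<longleftrightarrow> (\<Prod>i\<in>F. fps_geometric (\<delta> i)) * hilbert F = hilbert {}"
proof -
  let ?P = "\<Prod>i\<in>F. fps_geometric (\<delta> i)" and ?Q = "\<Prod>i\<in>F. 1 - fps_X ^ \<delta> i"
  have PQ: "?P * ?Q = 1" by (rule geometric_prod_inverse[OF assms])
  have "?P * (hilbert {} * ?Q) = ?P * ?Q * hilbert {}" by (simp only: mult_ac)
  moreover have "?P * hilbert F * ?Q = ?P * ?Q * hilbert F" by (simp only: mult_ac)
  ultimately show ?thesis unfolding regular_def PQ by (metis mult_1)
qed

lemma hilbert_lower_bound:
  assumes "finite F" "F \<subseteq> Ix"
  shows "fps_nonneg ((\<Prod>i\<in>F. fps_geometric (\<delta> i)) * hilbert F - hilbert {})"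
  using assms
proof (induction F rule: finite_induct)
  case empty then show ?case by (simp add: fps_nonneg_def)
next
  case (insert f F)
  have eq: "(\<Prod>i\<in>insert f F. fps_geometric (\<delta> i)) * hilbert (insert f F) - hilbert {}
    = ((\<Prod>i\<in>F. fps_geometric (\<delta> i)) * hilbert F - hilbert {}) + (\<Prod>i\<in>insert f F. fps_geometric (\<delta> i)) * excess F f"
    using geometric_hilbert_insert[OF insert.hyps insert.prems] by simp
  show ?case unfolding eq
    by (intro fps_nonneg_add fps_nonneg_mult fps_geometric_prod_nonneg excess_nonneg insert.IH insert.hyps)
      (use insert.prems in auto)
qed

text \<open>The normalised Hilbert series grows from \<open>hilbert {}\<close> by nonnegative steps. For a regular family
  the total growth is zero, so every step in every order of the family is zero.\<close>

lemma regular_insertD: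
  assumes "finite F" "f \<notin> F" "insert f F \<subseteq> Ix" "regular (insert f F)"
  shows "regular F" "excess F f = 0"
proof -
  let ?G = "\<lambda>F. \<Prod>i\<in>F. fps_geometric (\<delta> i)"
  have "(?G F * hilbert F - hilbert {}) + ?G (insert f F) * excess F f = 0"
    using geometric_hilbert_insert[OF assms(1-3)] assms(4)
    unfolding regular_iff[OF assms(3)] by (metis add_diff_eq add.commute diff_self)
  then have "?G F * hilbert F - hilbert {} = 0 \<and> ?G (insert f F) * excess F f = 0"
    using assms(1-3) by (intro fps_nonneg_add_eq_0 hilbert_lower_bound fps_nonneg_mult fps_geometric_prod_nonneg excess_nonneg) auto
  moreover have "?G (insert f F) \<noteq> 0" using geometric_prod_inverse[OF assms(3)] by (metis mult_zero_left zero_neq_one)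
  ultimately show "regular F" "excess F f = 0" using assms(3) by (auto simp: regular_iff)
qed

text \<open>Some power of \<open>\<phi> g\<close> is \<open>w + \<phi> f * h\<close> with \<open>w\<close> in the ideal of \<open>F\<close>. If \<open>\<phi> f\<close> kills \<open>v\<close> modulo
  \<open>F\<close>, then so does this power, and \<open>\<phi> g\<close> is a nonzerodivisor modulo \<open>F\<close> because the family with
  \<open>g\<close> is regular. Hence \<open>v = 0\<close> modulo \<open>F\<close>.\<close>

lemma regular_exchange:
  assumes "finite F" "f \<notin> F" "g \<notin> F" "insert f F \<subseteq> Ix" "g \<in> Ix" "regular (insert g F)"
    and rad: "\<phi> g \<in> ideal_radical (ideal_gen \<phi> (insert f F))"
  shows "regular (insert f F)"
proof -
  have g: "insert g F \<subseteq> Ix" using assms(4,5) by simp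
  note reg = regular_insertD[OF assms(1,3) g assms(6)]
  have cancel_g: "v \<in> gr_ideal F l"
    if "v \<in> homog V l" "\<phi> g * v \<in> gr_ideal F (l + int (\<delta> g))" for l v
    using reg(2) excess_eq_0_iff[OF assms(1,3) g] that by blast
  have cancel_g_power: "v \<in> gr_ideal F l"
    if "v \<in> homog V l" "\<phi> g ^ N * v \<in> gr_ideal F (l + int N * int (\<delta> g))" for l v N
    using that
  proof (induction N arbitrary: v l)
    case 0 then show ?case by simp
  next
    case (Suc N)
    have "\<phi> g * v \<in> homog V (int (\<delta> g) + l)" by (intro homog_mult form_homog assms(5) Suc.prems)
    moreover have "\<phi> g ^ N * (\<phi> g * v) \<in> gr_ideal F ((int (\<delta> g) + l) + int N * int (\<delta> g))"
      using Suc.prems(2) by (simp add: algebra_simps)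
    ultimately have "\<phi> g * v \<in> gr_ideal F (int (\<delta> g) + l)" by (rule Suc.IH)
    then show ?case using cancel_g[OF Suc.prems(1)] by (simp add: add.commute)
  qed
  obtain N where "\<phi> g ^ N \<in> ideal_gen \<phi> (insert f F)" using rad unfolding ideal_radical_def by blast
  then have "\<phi> g ^ N \<in> gr_ideal (insert f F) (int N * int (\<delta> g))"
    by (intro gr_ideal_of_ideal_gen assms(4) homog_power form_homog assms(5))
  then obtain w h where wh: "\<phi> g ^ N = w + \<phi> f * h" "w \<in> gr_ideal F (int N * int (\<delta> g))"
    "h \<in> homog V (int N * int (\<delta> g) - int (\<delta> f))"
    unfolding gr_ideal_insert[OF assms(1,2)] by blast
  have "v \<in> gr_ideal F l" if v: "v \<in> homog V l" "\<phi> f * v \<in> gr_ideal F (l + int (\<delta> f))" for l v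
  proof -
    have "\<phi> g ^ N * v = v * w + h * (\<phi> f * v)" by (simp add: wh(1) algebra_simps)
    moreover have "v * w \<in> gr_ideal F (l + int N * int (\<delta> g))"
      using gr_ideal_mult[OF v(1) wh(2)] by (simp add: add.commute)
    moreover have "h * (\<phi> f * v) \<in> gr_ideal F (l + int N * int (\<delta> g))"
      using gr_ideal_mult[OF wh(3) v(2)] by (simp add: algebra_simps)
    ultimately show ?thesis using cancel_g_power[OF v(1)] gr_ideal_add by metis
  qed
  then have "excess F f = 0" using excess_eq_0_iff[OF assms(1,2,4)] by blast
  then show ?thesis
    using hilbert_insert[OF assms(1,2,4)] reg(1) assms(1,2) by (simp add: regular_def mult_ac)
qed

end

section \<open>Avoiding sparse exceptional sets\<close>

text \<open>Each coordinate has boundedly many forbidden values, depending on the other coordinates. On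
  a grid with \<open>Q\<close> values per coordinate, one coordinate forbids at most a fraction \<open>C / Q\<close>
  of the points; for large \<open>Q\<close> some point is left. The bound on the forbidden sets has to be uniform:
  finiteness alone would not suffice.\<close>

lemma avoid_small_fibres:
  fixes B :: "'p \<Rightarrow> ('p \<Rightarrow> nat) \<Rightarrow> nat set"
  assumes "finite P"
    and indep: "\<And>p s v. p \<in> P \<Longrightarrow> B p (s(p := v)) = B p s"
    and small: "\<And>p s. p \<in> P \<Longrightarrow> finite (B p s) \<and> card (B p s) \<le> C"
  shows "\<exists>s. \<forall>p\<in>P. s p \<notin> B p s"
proof (rule ccontr)
  assume no: "\<not> ?thesis"
  then have "P \<noteq> {}" by blast
  then have cardP: "card P > 0" using \<open>finite P\<close> by (simp add: card_gt_0_iff)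
  \<comment> \<open>With this many values per coordinate, the forbidden fractions add up to less than \<open>1\<close>.\<close>
  define Q where "Q = card P * C + 1"
  let ?U = "PiE P (\<lambda>_. {..<Q})"
  let ?bad = "\<lambda>p. {s \<in> ?U. s p \<in> B p s}"
  have bad: "card (?bad p) \<le> Q ^ (card P - 1) * C" if p: "p \<in> P" for p
  proof -
    let ?R = "PiE (P - {p}) (\<lambda>_. {..<Q})"
    let ?S = "Sigma ?R (\<lambda>s. B p s)"
    have finR: "finite ?R" using \<open>finite P\<close> by (intro finite_PiE) auto
    have "?bad p \<subseteq> (\<lambda>(s, v). s(p := v)) ` ?S"
    proof
      fix s assume s: "s \<in> ?bad p"
      let ?s' = "restrict s (P - {p})"
      have eq: "?s'(p := s p) = s" using s by (auto simp: fun_eq_iff PiE_def extensional_def)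
      have "B p ?s' = B p s" using indep[OF p, of ?s' "s p"] eq by simp
      then have "(?s', s p) \<in> ?S" using s by auto
      then show "s \<in> (\<lambda>(s, v). s(p := v)) ` ?S" using eq by (intro image_eqI[of _ _ "(?s', s p)"]) simp_all
    qed
    moreover have finS: "finite ?S" using finR small[OF p] by blast
    ultimately have "card (?bad p) \<le> card ?S" by (meson card_image_le card_mono finite_imageI order_trans)
    also have "\<dots> = (\<Sum>s\<in>?R. card (B p s))" using finR small[OF p] by simp
    also have "\<dots> \<le> (\<Sum>s\<in>?R. C)" using small[OF p] by (intro sum_mono) blast
    also have "\<dots> = Q ^ (card P - 1) * C" using \<open>finite P\<close> p by (simp add: card_PiE)
    finally show ?thesis .
  qed
  have "?U = (\<Union>p\<in>P. ?bad p)" using no by blast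
  then have "card ?U \<le> (\<Sum>p\<in>P. card (?bad p))" using card_UN_le[OF \<open>finite P\<close>, of ?bad] by simp
  also have "\<dots> \<le> card P * (Q ^ (card P - 1) * C)" using sum_mono[of P "\<lambda>p. card (?bad p)", OF bad] by simp
  also have "\<dots> = (card P * C) * Q ^ (card P - 1)" by simp
  also have "\<dots> < Q * Q ^ (card P - 1)" by (simp add: Q_def)
  also have "\<dots> = Q ^ card P" using cardP by (simp flip: power_Suc)
  also have "\<dots> = card ?U" using \<open>finite P\<close> by (simp add: card_PiE)
  finally show False by simp
qed

lemma digits_unique_lessThan:
  fixes g h :: "nat \<Rightarrow> nat"
  assumes "\<And>j. g j \<le> D" "\<And>j. h j \<le> D"
    and "(\<Sum>j<M. g j * (D + 1) ^ j) = (\<Sum>j<M. h j * (D + 1) ^ j)" and "j < M"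
  shows "g j = h j"
  using assms
proof (induction M arbitrary: g h j)
  case 0 then show ?case by simp
next
  case (Suc M)
  have shift: "(\<Sum>j<Suc M. f j * q ^ j) = f 0 + q * (\<Sum>j<M. f (Suc j) * q ^ j)" for f and q :: nat
    by (simp add: sum.lessThan_Suc_shift sum_distrib_left mult_ac del: sum.lessThan_Suc)
  have mod: "(f 0 + (D + 1) * q) mod (D + 1) = f 0" "(f 0 + (D + 1) * q) div (D + 1) = q"
    if "f 0 \<le> D" for f :: "nat \<Rightarrow> nat" and q
    using that by (simp_all only: mod_mult_self2 div_mult_self2) auto
  note eq = Suc.prems(3)[unfolded shift]
  have "g 0 = h 0" using mod(1)[of g] mod(1)[of h] Suc.prems(1,2) eq by metis
  moreover have "(\<Sum>j<M. g (Suc j) * (D + 1) ^ j) = (\<Sum>j<M. h (Suc j) * (D + 1) ^ j)"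
    using mod(2)[of g] mod(2)[of h] Suc.prems(1,2) eq by metis
  then have "g (Suc i) = h (Suc i)" if "i < M" for i
    using Suc.IH[of "\<lambda>j. g (Suc j)" "\<lambda>j. h (Suc j)" i] Suc.prems(1,2) that by simp
  ultimately show ?case using Suc.prems(4) by (cases j) auto
qed

lemma inj_on_digits:
  assumes "J \<subseteq> {..<M}"
  shows "inj_on (\<lambda>u. \<Sum>j\<in>J. u j * (D + 1) ^ j) (PiE J (\<lambda>_. {..D::nat}))"
proof (rule inj_onI)
  fix u v assume u: "u \<in> PiE J (\<lambda>_. {..D})" and v: "v \<in> PiE J (\<lambda>_. {..D})"
    and eq: "(\<Sum>j\<in>J. u j * (D + 1) ^ j) = (\<Sum>j\<in>J. v j * (D + 1) ^ j)"
  \<comment> \<open>Positions outside \<open>J\<close> get the digit zero.\<close>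
  let ?ext = "\<lambda>u j. if j \<in> J then u j else 0"
  have ext: "(\<Sum>j<M. ?ext w j * (D + 1) ^ j) = (\<Sum>j\<in>J. w j * (D + 1) ^ j)" for w
    using assms by (intro sum.mono_neutral_cong_right) auto
  have "?ext u j \<le> D" "?ext v j \<le> D" for j using u v by (auto dest: PiE_mem)
  then have "?ext u j = ?ext v j" if "j < M" for j
    using digits_unique_lessThan[of "?ext u" D "?ext v" M j] ext eq that by simp
  then have "u j = v j" if "j \<in> J" for j using assms that by (metis lessThan_iff subsetD)
  then show "u = v" using u v by (auto intro: PiE_ext)
qed

text \<open>The sum is the value at \<open>v\<close> of a polynomial of degree at most \<open>C\<close>, which is nonzero since
  distinct terms have distinct exponents.\<close>

lemma card_roots_sparse_le:
  fixes h :: "'u \<Rightarrow> rat" and e :: "'u \<Rightarrow> nat"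
  assumes "finite U" "inj_on e U" "u \<in> U" "h u \<noteq> 0" "\<And>u. u \<in> U \<Longrightarrow> e u \<le> C"
  shows "finite {v::nat. (\<Sum>u\<in>U. h u * of_nat v ^ e u) = 0} \<and>
    card {v::nat. (\<Sum>u\<in>U. h u * of_nat v ^ e u) = 0} \<le> C"
proof -
  define P where "P = (\<Sum>u\<in>U. monom (h u) (e u))"
  have poly: "poly P (of_nat v) = (\<Sum>u\<in>U. h u * of_nat v ^ e u)" for v
    by (simp add: P_def poly_sum poly_monom)
  have "coeff P (e u) = (\<Sum>w\<in>U. if w = u then h w else 0)"
    unfolding P_def coeff_sum using assms(2,3) by (intro sum.cong) (auto simp: inj_on_def)
  then have nz: "P \<noteq> 0" using assms(1,3,4) by auto
  have "degree P \<le> C" unfolding P_def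
    using assms(5) by (intro degree_sum_le assms(1)) (meson degree_monom_le order_trans)
  then have card: "card {x. poly P x = 0} \<le> C" using card_poly_roots_bound[OF nz] by linarith
  have fin: "finite {x. poly P x = 0}" by (rule poly_roots_finite[OF nz])
  let ?N = "{v::nat. (\<Sum>u\<in>U. h u * of_nat v ^ e u) = 0}"
  have sub: "of_nat ` ?N \<subseteq> {x. poly P x = 0}" by (auto simp: poly)
  have inj: "inj_on (of_nat :: nat \<Rightarrow> rat) ?N" by (simp add: inj_on_def)
  have "finite ?N" using finite_subset[OF sub fin] inj by (rule finite_imageD)
  moreover have "card ?N \<le> C" using card_inj_on_le[OF inj sub fin] card by linarith
  ultimately show ?thesis by blast
qed

section \<open>Generic forms\<close>

context weighted_variables
begin

definition var :: "'v \<Rightarrow> 'v mpoly" where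
  "var i = Poly_Mapping.single (Poly_Mapping.single i 1) 1"

lemma var_homog: "i \<in> W \<Longrightarrow> i \<in> V \<Longrightarrow> var i \<in> homog W (int (b i))"
  using wt_single[of i] by (simp add: homog_def mons_def var_def)

lemma single_0_mult: "Poly_Mapping.single 0 c * Poly_Mapping.single 0 c' = (Poly_Mapping.single 0 (c * c') :: 'v mpoly)"
  by (simp add: mult_single)

lemma single_0_power: "(Poly_Mapping.single 0 c :: 'v mpoly) ^ k = Poly_Mapping.single 0 (c ^ k)"
  by (induction k) (simp_all add: single_0_mult)

lemma single_0_prod: "(\<Prod>i\<in>S. Poly_Mapping.single 0 (f i) :: 'v mpoly) = Poly_Mapping.single 0 (\<Prod>i\<in>S. f i)"
  by (induction S rule: infinite_finite_induct) (simp_all add: single_0_mult)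

lemma single_0_sum: "(\<Sum>i\<in>S. Poly_Mapping.single 0 (f i) :: 'v mpoly) = Poly_Mapping.single 0 (\<Sum>i\<in>S. f i)"
  by (induction S rule: infinite_finite_induct) (simp_all add: single_add)

text \<open>Every monomial of positive degree is divisible by a variable.\<close>

lemma homog_in_ideal:
  assumes A: "is_ideal A" and vars: "\<And>i. i \<in> V \<Longrightarrow> var i \<in> A" and p: "p \<in> homog V (int k)" "k > 0"
  shows "p \<in> A"
proof -
  have "p = (\<Sum>m\<in>keys p. Poly_Mapping.single m (lookup p m))"
    by (rule poly_mapping_eqI) (simp add: lookup_sum lookup_single when_def in_keys_iff)
  also have "\<dots> \<in> A"
  proof (rule is_ideal_sum[OF A])
    fix m assume "m \<in> keys p"
    then have m: "keys m \<subseteq> V" "wt m = k" using p(1) unfolding homog_def mons_def by auto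
    have "(\<Sum>i\<in>V. lookup m i * b i) \<noteq> 0" using m(2) p(2) by (simp add: wt_def)
    then obtain i where "i \<in> V" "lookup m i * b i \<noteq> 0" by (rule sum.not_neutral_contains_not_neutral)
    then have i: "i \<in> keys m" by (simp add: in_keys_iff)
    let ?x = "Poly_Mapping.single i (1::nat)"
    have "m = (m - ?x) + ?x"
      using i by (intro poly_mapping_eqI) (auto simp: lookup_add lookup_minus lookup_single when_def in_keys_iff)
    then have "Poly_Mapping.single m (lookup p m) = Poly_Mapping.single (m - ?x) (lookup p m) * var i"
      unfolding var_def mult_single by simp
    then show "Poly_Mapping.single m (lookup p m) \<in> A" using i m(1) vars is_idealD(3)[OF A] by auto
  qed
  finally show ?thesis .
qed

text \<open>The products all have degree \<open>D\<close> times the sum of the \<open>d j\<close>. There are \<open>(D + 1) ^ card J\<close> of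
  them, while the space that contains them has a dimension of order \<open>D ^ (card I - 1)\<close>.\<close>

lemma exists_relation:
  assumes I: "I \<subseteq> V" "I \<noteq> {}" and J: "finite J" "card I \<le> card J"
    and r: "\<And>j. j \<in> J \<Longrightarrow> r j \<in> homog I (int (d j))" and m: "\<And>j. j \<in> J \<Longrightarrow> m j \<in> homog I (int (d j))"
    and d: "\<And>j. j \<in> J \<Longrightarrow> d j > 0" and D: "(\<Sum>j\<in>J. d j) ^ card V \<le> D"
  shows "\<exists>h. (\<exists>u\<in>PiE J (\<lambda>_. {..D}). h u \<noteq> 0) \<and>
    (\<Sum>u\<in>PiE J (\<lambda>_. {..D}). Poly_Mapping.single 0 (h u) * (\<Prod>j\<in>J. r j ^ u j * m j ^ (D - u j))) = 0"
proof (rule mp.linear_relation_of_card)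
  let ?\<sigma> = "\<Sum>j\<in>J. d j"
  let ?k = "int (D * ?\<sigma>)"
  let ?Y = "(\<lambda>m. Poly_Mapping.single m 1 :: 'v mpoly) ` mons I ?k"
  obtain i where i: "i \<in> I" using I(2) by blast
  have cardI: "card I > 0" "card I \<le> card V"
    using I finite_V by (auto simp: card_gt_0_iff finite_subset intro: card_mono)
  have "J \<noteq> {}" using J cardI by auto
  then have \<sigma>: "?\<sigma> \<ge> 1" using d J(1) by (metis One_nat_def Suc_leI sum_pos)
  show "finite (PiE J (\<lambda>_. {..D}))" using J(1) by (intro finite_PiE) auto
  show finY: "finite ?Y" using finite_mons[OF I(1)] by simp
  show "(\<Prod>j\<in>J. r j ^ u j * m j ^ (D - u j)) \<in> mp.span ?Y" if u: "u \<in> PiE J (\<lambda>_. {..D})" for u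
  proof -
    have "r j ^ u j * m j ^ (D - u j) \<in> homog I (int D * int (d j))" if j: "j \<in> J" for j
    proof -
      have "u j \<le> D" using u j by (auto dest: PiE_mem)
      then have "int (u j) * int (d j) + int (D - u j) * int (d j) = int D * int (d j)"
        by (simp add: of_nat_diff algebra_simps)
      then show ?thesis using homog_mult[OF homog_power[OF r[OF j]] homog_power[OF m[OF j]], of "u j" "D - u j"] by simp
    qed
    then have "(\<Prod>j\<in>J. r j ^ u j * m j ^ (D - u j)) \<in> homog I (\<Sum>j\<in>J. int D * int (d j))" by (rule homog_prod)
    then show ?thesis using homog_subset_span[of I ?k] by (simp add: sum_distrib_left subset_iff)
  qed
  have "card ?Y \<le> card (mons I ?k)" using finite_mons[OF I(1)] by (rule card_image_le)
  also have "\<dots> \<le> (D * ?\<sigma> + 1) ^ (card I - 1)" using finite_card_mons(2)[OF I(1) i, of ?k] unfolding nat_int .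
  also have "\<dots> \<le> ((D + 1) * ?\<sigma>) ^ (card I - 1)" using \<sigma> by (intro power_mono) auto
  also have "\<dots> = ?\<sigma> ^ (card I - 1) * (D + 1) ^ (card I - 1)" by (simp only: power_mult_distrib mult.commute)
  also have "\<dots> < (D + 1) * (D + 1) ^ (card I - 1)"
  proof (rule mult_strict_right_mono)
    have "?\<sigma> ^ (card I - 1) \<le> ?\<sigma> ^ card V" using \<sigma> cardI by (intro power_increasing) auto
    then show "?\<sigma> ^ (card I - 1) < D + 1" using D by linarith
  qed simp
  also have "\<dots> = (D + 1) ^ card I" using cardI(1) by (simp flip: power_Suc)
  also have "\<dots> \<le> (D + 1) ^ card J" using J(2) by (intro power_increasing) auto
  also have "\<dots> = card (PiE J (\<lambda>_. {..D}))" using J(1) by (simp add: card_PiE)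
  finally show "card ?Y < card (PiE J (\<lambda>_. {..D}))" .
qed

end

text \<open>The form with index \<open>j\<close> has degree \<open>d j\<close>. The set \<open>S j\<close> consists of sets \<open>K\<close> of variables in which a
  monomial of this degree exists, and \<open>E j K\<close> is the exponent vector of one such monomial. One
  monomial for each \<open>K\<close> is all that genericity needs: it makes the form visible on the stratum
  of \<open>K\<close>.\<close>

locale generic_forms = weighted_variables V b for V :: "'v set" and b :: "'v \<Rightarrow> nat" +
  fixes M :: nat and d :: "nat \<Rightarrow> nat" and S :: "nat \<Rightarrow> 'v set set" and E :: "nat \<Rightarrow> 'v set \<Rightarrow> 'v \<Rightarrow> nat"
  assumes d_pos: "j < M \<Longrightarrow> d j > 0"
    and supports: "S j \<subseteq> Pow V"
    and exponent_support: "K \<in> S j \<Longrightarrow> i \<notin> K \<Longrightarrow> E j K i = 0"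
    and exponent_weight: "K \<in> S j \<Longrightarrow> (\<Sum>i\<in>V. E j K i * b i) = d j"
begin

text \<open>The range of exponents for which \<open>exists_relation\<close> yields relations, for every subset of the
  forms at once.\<close>

definition grid_bound :: nat where "grid_bound = (\<Sum>j<M. d j) ^ card V"

definition mono_with_support :: "nat \<Rightarrow> 'v set \<Rightarrow> 'v mpoly" where
  "mono_with_support j K = (\<Prod>i\<in>V. var i ^ E j K i)"

text \<open>The coefficient depends on a single parameter \<open>s K\<close> for each \<open>K\<close>, shared by all \<open>j\<close>. Because of the
  exponents, a monomial in these coefficients with exponents at most \<open>grid_bound\<close> is, up to sign, a power of
  \<open>s K\<close> whose exponent has the given exponents as digits; no two terms of a relation can then
  cancel. Because of the sign, the rest of the form is congruent to a positive multiple of its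
  \<open>I\<close>-monomial modulo the form.\<close>

definition coef :: "('v set \<Rightarrow> nat) \<Rightarrow> nat \<Rightarrow> 'v set \<Rightarrow> rat" where
  "coef s j K = - (of_nat (s K) ^ ((grid_bound + 1) ^ j))"

definition form :: "('v set \<Rightarrow> nat) \<Rightarrow> nat \<Rightarrow> 'v mpoly" where
  "form s j = (\<Sum>K\<in>S j. Poly_Mapping.single 0 (coef s j K) * mono_with_support j K)"

text \<open>By the Nullstellensatz this says that, over an algebraic closure, the forms with index in \<open>J\<close>
  have no common zero at which exactly the variables in \<open>I\<close> are nonzero.\<close>

definition stratum_ok :: "('v set \<Rightarrow> nat) \<Rightarrow> nat set \<Rightarrow> 'v set \<Rightarrow> bool" where
  "stratum_ok s J I \<longleftrightarrow>
     (\<Prod>i\<in>I. var i) \<in> ideal_radical (ideal_plus (ideal_gen (form s) J) (ideal_gen var (V - I)))"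

lemma finite_supports: "finite (S j)"
  using supports finite_V by (meson finite_Pow_iff finite_subset)

lemma mono_homog:
  assumes "K \<in> S j" "\<And>i. i \<in> V - I \<Longrightarrow> E j K i = 0"
  shows "mono_with_support j K \<in> homog I (int (d j))"
proof -
  have "var i ^ E j K i \<in> homog I (int (E j K i * b i))" if "i \<in> V" for i
  proof (cases "i \<in> I")
    case True then show ?thesis using homog_power[OF var_homog[OF True that]] by simp
  next
    case False then show ?thesis using assms(2) that homog_1 by simp
  qed
  then have "mono_with_support j K \<in> homog I (\<Sum>i\<in>V. int (E j K i * b i))" unfolding mono_with_support_def by (rule homog_prod)
  moreover have "(\<Sum>i\<in>V. int (E j K i * b i)) = int (d j)"
    using exponent_weight[OF assms(1)] by (metis of_nat_sum)
  ultimately show ?thesis by simp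
qed

lemma form_homog: "form s j \<in> homog V (int (d j))"
  unfolding form_def by (intro homog_sum homog_scale mono_homog) auto

lemma mono_in_ideal:
  assumes "is_ideal A" "i \<in> V" "E j K i > 0" "var i \<in> A" shows "mono_with_support j K \<in> A"
proof -
  have "var i ^ E j K i = var i ^ (E j K i - 1) * var i" using assms(3) by (simp flip: power_Suc2)
  then have "mono_with_support j K = (\<Prod>i\<in>V - {i}. var i ^ E j K i) * var i ^ (E j K i - 1) * var i"
    unfolding mono_with_support_def using assms(2) finite_V by (subst prod.remove[of _ i]) (auto simp: mult_ac)
  then show ?thesis using assms(1,4) by (simp add: is_idealD)
qed

lemma mono_dvd_power:
  assumes "I \<in> S j" shows "mono_with_support j I dvd (\<Prod>i\<in>I. var i) ^ d j"
proof -
  have I: "I \<subseteq> V" using assms supports by blast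
  have E_le: "E j I i \<le> d j" if "i \<in> V" for i
  proof -
    have "E j I i \<le> E j I i * b i" using weight_pos[OF that] by simp
    also have "\<dots> \<le> (\<Sum>i\<in>V. E j I i * b i)" using finite_V that by (intro member_le_sum) auto
    finally show ?thesis using exponent_weight[OF assms] by simp
  qed
  have "mono_with_support j I = (\<Prod>i\<in>I. var i ^ E j I i)"
    unfolding mono_with_support_def using I finite_V exponent_support[OF assms]
    by (intro prod.mono_neutral_right) auto
  also have "\<dots> dvd (\<Prod>i\<in>I. var i ^ d j)"
    using I E_le by (intro prod_dvd_prod le_imp_power_dvd) auto
  finally show ?thesis by (simp add: prod_power_distrib)
qed

text \<open>Modulo the variables outside \<open>I\<close>, the form \<open>j\<close> is \<open>r j\<close> plus its \<open>I\<close>-monomial times a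
  coefficient that depends on \<open>v\<close>, whereas \<open>r j\<close> does not depend on \<open>v\<close>. The \<open>r j\<close> and the \<open>I\<close>-monomials satisfy a relation
  by \<open>exists_relation\<close>. Substituting the coefficients gives a polynomial in \<open>v\<close>; unless it vanishes, a
  product of powers of the \<open>I\<close>-monomials, and hence a power of the product of the variables in \<open>I\<close>, lies in
  the ideal. The bound on the number of exceptions does not depend on the other parameters, as
  required by \<open>avoid_small_fibres\<close>.\<close>

lemma few_bad_coefficients:
  assumes I: "I \<subseteq> V" "I \<noteq> {}" "\<And>j. j \<in> J \<Longrightarrow> I \<in> S j" and J: "J \<subseteq> {..<M}" "card I \<le> card J"
  shows "finite {v. \<not> stratum_ok (s(I := v)) J I} \<and>
    card {v. \<not> stratum_ok (s(I := v)) J I} \<le> M * (grid_bound * (grid_bound + 1) ^ M)"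
proof -
  have finJ: "finite J" using J(1) finite_subset by blast
  note IV = I(1)
  \<comment> \<open>The monomials of the form \<open>j\<close>, other than its \<open>I\<close>-monomial, that survive when the variables outside \<open>I\<close> are set to zero.\<close>
  define T where "T j = {K \<in> S j - {I}. \<forall>i\<in>V - I. E j K i = 0}" for j
  define r where "r j = (\<Sum>K\<in>T j. Poly_Mapping.single 0 (coef s j K) * mono_with_support j K)" for j
  let ?U = "PiE J (\<lambda>_. {..grid_bound})" and ?e = "\<lambda>u. \<Sum>j\<in>J. u j * (grid_bound + 1) ^ j"
  have r: "r j \<in> homog I (int (d j))" for j
    unfolding r_def T_def by (intro homog_sum homog_scale mono_homog) auto
  have m: "mono_with_support j I \<in> homog I (int (d j))" if "j \<in> J" for j
    using I(3)[OF that] exponent_support by (intro mono_homog) auto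
  have "(\<Sum>j\<in>J. d j) \<le> (\<Sum>j<M. d j)" using J(1) by (intro sum_mono2) auto
  then have "(\<Sum>j\<in>J. d j) ^ card V \<le> grid_bound" unfolding grid_bound_def by (intro power_mono) auto
  then obtain h where h: "\<exists>u\<in>?U. h u \<noteq> 0"
    "(\<Sum>u\<in>?U. Poly_Mapping.single 0 (h u) * (\<Prod>j\<in>J. r j ^ u j * mono_with_support j I ^ (grid_bound - u j))) = 0"
    using exists_relation[OF IV I(2) finJ J(2), of r d "\<lambda>j. mono_with_support j I" grid_bound] r m d_pos J(1) by blast
  have ok: "stratum_ok (s(I := v)) J I" if nz: "(\<Sum>u\<in>?U. h u * of_nat v ^ ?e u) \<noteq> 0" for v
  proof -
    let ?s = "s(I := v)"
    let ?A = "ideal_plus (ideal_gen (form ?s) J) (ideal_gen var (V - I))"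
    let ?\<gamma> = "\<lambda>j. Poly_Mapping.single 0 (of_nat v ^ ((grid_bound + 1) ^ j)) :: 'v mpoly"
    have A: "is_ideal ?A" by (intro is_ideal_plus is_ideal_ideal_gen)
    have cong: "r j - ?\<gamma> j * mono_with_support j I \<in> ?A" if j: "j \<in> J" for j
    proof -
      let ?g = "\<lambda>K. Poly_Mapping.single 0 (coef ?s j K) * mono_with_support j K"
      have form_in: "form ?s j \<in> ?A"
        by (intro ideal_plus_left is_ideal_ideal_gen ideal_gen_base finJ j)
      have form: "form ?s j = ?g I + (\<Sum>K\<in>S j - {I}. ?g K)"
        unfolding form_def using I(3)[OF j] finite_supports by (simp add: sum.remove)
      have rest: "(\<Sum>K\<in>S j - {I}. ?g K) = (\<Sum>K\<in>S j - {I} - T j. ?g K) + (\<Sum>K\<in>T j. ?g K)"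
        using finite_supports by (intro sum.subset_diff) (auto simp: T_def)
      have T: "(\<Sum>K\<in>T j. ?g K) = r j"
        unfolding r_def by (intro sum.cong) (auto simp: T_def coef_def)
      have g: "?g I = - (?\<gamma> j * mono_with_support j I)" by (simp add: coef_def single_uminus)
      have rest_in: "(\<Sum>K\<in>S j - {I} - T j. ?g K) \<in> ?A"
      proof (intro is_ideal_sum[OF A] is_idealD(3)[OF A])
        fix K assume "K \<in> S j - {I} - T j"
        then obtain i where i: "i \<in> V - I" "E j K i > 0" by (auto simp: T_def)
        have "var i \<in> ?A"
          using i finite_V by (intro ideal_plus_right is_ideal_ideal_gen ideal_gen_base) auto
        then show "mono_with_support j K \<in> ?A" using mono_in_ideal[OF A _ i(2)] i(1) by blast
      qed
      have "r j - ?\<gamma> j * mono_with_support j I = form ?s j - (\<Sum>K\<in>S j - {I} - T j. ?g K)"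
        unfolding form rest T g by simp
      then show ?thesis using is_idealD(6)[OF A form_in rest_in] by simp
    qed
    let ?H = "\<Sum>u\<in>?U. h u * of_nat v ^ ?e u" and ?P = "\<Prod>j\<in>J. mono_with_support j I ^ grid_bound"
    have "(\<Sum>u\<in>?U. Poly_Mapping.single 0 (h u) * (\<Prod>j\<in>J. ?\<gamma> j ^ u j)) * ?P \<in> ?A"
      by (rule relation_gives_monomial_in_ideal[OF A cong h(2)]) (auto dest: PiE_mem)
    moreover have "(\<Sum>u\<in>?U. Poly_Mapping.single 0 (h u) * (\<Prod>j\<in>J. ?\<gamma> j ^ u j)) = Poly_Mapping.single 0 ?H"
      by (simp add: single_0_power single_0_prod single_0_mult single_0_sum power_sum mult.commute flip: power_mult)
    ultimately have "Poly_Mapping.single 0 ?H * ?P \<in> ?A" by (simp only:)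
    then have "Poly_Mapping.single 0 (1 / ?H) * (Poly_Mapping.single 0 ?H * ?P) \<in> ?A"
      by (rule is_idealD(3)[OF A])
    moreover have "Poly_Mapping.single 0 (1 / ?H) * (Poly_Mapping.single 0 ?H * ?P) = ?P"
      using nz by (simp only: single_0_mult flip: mult.assoc) simp
    ultimately have "?P \<in> ?A" by (simp only:)
    moreover have "?P dvd (\<Prod>j\<in>J. ((\<Prod>i\<in>I. var i) ^ d j) ^ grid_bound)"
      using I(3) by (intro prod_dvd_prod dvd_power_same mono_dvd_power) auto
    then have "?P dvd (\<Prod>i\<in>I. var i) ^ (\<Sum>j\<in>J. d j * grid_bound)"
      by (simp add: power_sum power_mult)
    then obtain q where "(\<Prod>i\<in>I. var i) ^ (\<Sum>j\<in>J. d j * grid_bound) = ?P * q" by (rule dvdE)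
    ultimately have "(\<Prod>i\<in>I. var i) ^ (\<Sum>j\<in>J. d j * grid_bound) \<in> ?A"
      using is_idealD(4)[OF A] by simp
    then show ?thesis unfolding stratum_ok_def ideal_radical_def by blast
  qed
  then have sub: "{v. \<not> stratum_ok (s(I := v)) J I} \<subseteq> {v. (\<Sum>u\<in>?U. h u * of_nat v ^ ?e u) = 0}" by blast
  obtain u where u: "u \<in> ?U" "h u \<noteq> 0" using h(1) by blast
  have e_le: "?e u \<le> M * (grid_bound * (grid_bound + 1) ^ M)" if "u \<in> ?U" for u
  proof -
    have "u j * (grid_bound + 1) ^ j \<le> grid_bound * (grid_bound + 1) ^ M" if "j \<in> J" for j
      using PiE_mem[OF \<open>u \<in> ?U\<close> that] J(1) that by (intro mult_mono power_increasing) auto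
    then have "?e u \<le> card J * (grid_bound * (grid_bound + 1) ^ M)" using sum_bounded_above[of J "\<lambda>j. u j * (grid_bound + 1) ^ j"] by simp
    also have "\<dots> \<le> M * (grid_bound * (grid_bound + 1) ^ M)" using card_mono[OF _ J(1)] by (intro mult_right_mono) auto
    finally show ?thesis .
  qed
  have "finite ?U" using finJ by (intro finite_PiE) auto
  from card_roots_sparse_le[where h = h, OF this inj_on_digits[OF J(1)] u e_le]
  have *: "finite {v. (\<Sum>u\<in>?U. h u * of_nat v ^ ?e u) = 0}"
    "card {v. (\<Sum>u\<in>?U. h u * of_nat v ^ ?e u) = 0} \<le> M * (grid_bound * (grid_bound + 1) ^ M)" by auto
  show ?thesis using finite_subset[OF sub *(1)] card_mono[OF *(1) sub] *(2) by simp
qed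

text \<open>There are finitely many strata and sets \<open>J\<close>, so the exceptional values for one parameter stay
  uniformly bounded when they are collected over all \<open>J\<close>.\<close>

lemma generic_parameters_exist:
  "\<exists>s. \<forall>I J. I \<subseteq> V \<longrightarrow> I \<noteq> {} \<longrightarrow> J \<subseteq> {..<M} \<longrightarrow> (\<forall>j\<in>J. I \<in> S j) \<longrightarrow> card I \<le> card J \<longrightarrow> stratum_ok s J I"
proof -
  let ?Js = "\<lambda>I. {J. J \<subseteq> {..<M} \<and> (\<forall>j\<in>J. I \<in> S j) \<and> card I \<le> card J}"
  \<comment> \<open>The parameter of \<open>I\<close> is overwritten by \<open>v\<close>, so this set depends on the other parameters only.\<close>
  let ?B = "\<lambda>I s. \<Union>J\<in>?Js I. {v. \<not> stratum_ok (s(I := v)) J I}"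
  let ?C = "M * (grid_bound * (grid_bound + 1) ^ M)"
  have "\<exists>s. \<forall>I\<in>Pow V - {{}}. s I \<notin> ?B I s"
  proof (rule avoid_small_fibres[where C = "2 ^ M * ?C"])
    show "finite (Pow V - {{}})" using finite_V by simp
    show "?B I (s(I := v)) = ?B I s" for I s v by simp
    fix I s assume I: "I \<in> Pow V - {{}}"
    have sub: "?Js I \<subseteq> Pow {..<M}" by auto
    then have fin: "finite (?Js I)" by (rule finite_subset) simp
    have few: "finite {v. \<not> stratum_ok (s(I := v)) J I}" "card {v. \<not> stratum_ok (s(I := v)) J I} \<le> ?C"
      if "J \<in> ?Js I" for J
      using few_bad_coefficients[of I J s] I that by auto
    have "card (?B I s) \<le> (\<Sum>J\<in>?Js I. card {v. \<not> stratum_ok (s(I := v)) J I})" by (rule card_UN_le[OF fin])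
    also have "\<dots> \<le> card (?Js I) * ?C"
      using sum_bounded_above[of "?Js I" "\<lambda>J. card {v. \<not> stratum_ok (s(I := v)) J I}" ?C] few(2)
      unfolding of_nat_id by blast
    also have "\<dots> \<le> 2 ^ M * ?C"
      using card_mono[OF _ sub] by (intro mult_right_mono) (auto simp: card_Pow)
    finally show "finite (?B I s) \<and> card (?B I s) \<le> 2 ^ M * ?C" using fin few(1) by blast
  qed
  then obtain s where s: "\<forall>I\<in>Pow V - {{}}. s I \<notin> ?B I s" by (rule exE)
  have "stratum_ok s J I" if "I \<subseteq> V" "I \<noteq> {}" "J \<in> ?Js I" for I J
  proof (rule ccontr)
    assume "\<not> stratum_ok s J I"
    then have "s I \<in> {v. \<not> stratum_ok (s(I := v)) J I}" by simp
    then have "s I \<in> ?B I s" using that(3) by (rule UN_I[rotated])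
    then show False using s that(1,2) by blast
  qed
  then show ?thesis by (intro exI[of _ s]) simp
qed

end

section \<open>From the variables to generic forms of prescribed degrees\<close>

text \<open>Where \<open>b\<close> takes the same value several times, one index carries the whole coefficient.\<close>

lemma semigroup_span_image_exponents:
  assumes "finite K" "v \<in> semigroup_span (b ` K)"
  shows "\<exists>e. (\<forall>i. i \<notin> K \<longrightarrow> e i = 0) \<and> (\<Sum>i\<in>K. e i * b i) = v"
proof -
  obtain K' where K': "K' \<subseteq> K" "inj_on b K'" "b ` K = b ` K'"
    using subset_image_inj[of "b ` K" b K] by auto
  obtain c where c: "v = (\<Sum>s\<in>b ` K. c s * s)" using assms(2) unfolding semigroup_span_def by blast
  let ?e = "\<lambda>i. if i \<in> K' then c (b i) else 0"
  have "v = (\<Sum>i\<in>K'. c (b i) * b i)" unfolding c K'(3) by (simp add: sum.reindex[OF K'(2)])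
  also have "\<dots> = (\<Sum>i\<in>K. ?e i * b i)"
    using K'(1) assms(1) by (intro sum.mono_neutral_cong_left) auto
  finally show ?thesis using K'(1) by (intro exI[of _ ?e]) auto
qed

locale sufficiently_generic_forms = generic_forms +
  fixes s :: "'a set \<Rightarrow> nat"
  assumes generic: "I \<subseteq> V \<Longrightarrow> I \<noteq> {} \<Longrightarrow> J \<subseteq> {..<M} \<Longrightarrow> (\<And>j. j \<in> J \<Longrightarrow> I \<in> S j) \<Longrightarrow> card I \<le> card J
    \<Longrightarrow> stratum_ok s J I"
begin

abbreviation generator :: "'a + nat \<Rightarrow> 'a mpoly" where
  "generator \<equiv> case_sum var (form s)"

abbreviation gen_degree :: "'a + nat \<Rightarrow> nat" where
  "gen_degree \<equiv> case_sum b d"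

abbreviation indices :: "('a + nat) set" where
  "indices \<equiv> Inl ` V \<union> Inr ` {..<M}"

sublocale H: homogeneous_forms V b generator gen_degree indices
proof
  fix i assume i: "i \<in> indices"
  then show "generator i \<in> homog V (int (gen_degree i))" by (auto simp: var_homog form_homog)
  show "gen_degree i > 0" using i by (auto simp: weight_pos d_pos)
qed

text \<open>Enough equations for every stratum. Strata on which a variable belonging to \<open>F\<close> is nonzero
  need no forms, as that variable is an equation without solutions there.\<close>

definition admissible :: "('a + nat) set \<Rightarrow> bool" where
  "admissible F \<longleftrightarrow> (\<forall>I. I \<subseteq> V \<longrightarrow> I \<noteq> {} \<longrightarrow> (\<forall>i\<in>I. Inl i \<notin> F) \<longrightarrow>
     card I \<le> card {j. Inr j \<in> F \<and> I \<in> S j})"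

text \<open>All strata are free of zeros: by the choice of the parameters, or because of a variable in
  \<open>F\<close>.\<close>

lemma var_in_radical:
  assumes F: "F \<subseteq> indices" "admissible F" and i: "i \<in> V"
  shows "var i \<in> ideal_radical (ideal_gen generator F)"
proof (rule variables_in_ideal_radical[OF is_ideal_ideal_gen finite_V _ i])
  fix I assume I: "I \<subseteq> V" "I \<noteq> {}"
  let ?A = "ideal_gen generator F"
  have finF: "finite F" using finite_subset[OF F(1)] finite_V by simp
  show "(\<Prod>i\<in>I. var i) \<in> ideal_radical (ideal_plus ?A (ideal_gen var (V - I)))"
  proof (cases "\<exists>i\<in>I. Inl i \<in> F")
    case True
    then obtain i where i: "i \<in> I" "Inl i \<in> F" by blast
    have "(\<Prod>i\<in>I. var i) = (\<Prod>j\<in>I - {i}. var j) * var i"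
      using i(1) I(1) finite_V by (subst prod.remove[of _ i]) (auto intro: finite_subset simp: mult.commute)
    moreover have "var i \<in> ?A" using ideal_gen_base[OF finF i(2), of generator] by simp
    ultimately have "(\<Prod>i\<in>I. var i) \<in> ?A" using is_idealD(3)[OF is_ideal_ideal_gen] by simp
    then show ?thesis using ideal_plus_left[OF is_ideal_ideal_gen] subset_ideal_radical by blast
  next
    case False
    let ?J = "{j. Inr j \<in> F \<and> I \<in> S j}"
    have J: "?J \<subseteq> {..<M}" using F(1) by auto
    have "card I \<le> card ?J" using F(2) I False unfolding admissible_def by blast
    then have "stratum_ok s ?J I" using generic[OF I J] by blast
    moreover have "ideal_gen (form s) ?J \<subseteq> ?A"
    proof (rule ideal_gen_subset[OF is_ideal_ideal_gen])
      fix j assume "j \<in> ?J"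
      then show "form s j \<in> ?A" using ideal_gen_base[OF finF, of "Inr j" generator] by simp
    qed
    then have "ideal_plus (ideal_gen (form s) ?J) (ideal_gen var (V - I))
        \<subseteq> ideal_plus ?A (ideal_gen var (V - I))" unfolding ideal_plus_def by blast
    ultimately show ?thesis unfolding stratum_ok_def using ideal_radical_mono by blast
  qed
qed

lemma regular_replace:
  assumes "finite F" "f \<notin> F" "g \<notin> F" "insert f F \<subseteq> indices" "g \<in> indices"
    and "H.regular (insert g F)" and "admissible (insert f F)"
  shows "H.regular (insert f F)"
proof (rule H.regular_exchange[OF assms(1-6)])
  let ?R = "ideal_radical (ideal_gen generator (insert f F))"
  show "generator g \<in> ?R"
    using homog_in_ideal[OF is_ideal_ideal_radical[OF is_ideal_ideal_gen]
        var_in_radical[OF assms(4,7)] H.form_homog[OF assms(5)] H.degree_pos[OF assms(5)]] .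
qed

text \<open>The quotient by all variables is the field of constants, of Hilbert series \<open>1\<close>.\<close>

lemma regular_variables: "H.regular (Inl ` V)"
proof -
  let ?F = "Inl ` V :: ('a + nat) set"
  have fin: "finite ?F" using finite_V by simp
  have pos: "H.gr_ideal ?F (int k) = homog V (int k)" if "k > 0" for k
  proof (rule antisym[OF H.gr_ideal_subset_homog])
    show "homog V (int k) \<subseteq> H.gr_ideal ?F (int k)"
    proof
      fix p assume p: "p \<in> homog V (int k)"
      have "var i \<in> ideal_gen generator ?F" if "i \<in> V" for i
        using ideal_gen_base[OF fin, of "Inl i" generator] that by simp
      then have "p \<in> ideal_gen generator ?F" using homog_in_ideal[OF is_ideal_ideal_gen _ p that] by blast
      then show "p \<in> H.gr_ideal ?F (int k)" using H.gr_ideal_of_ideal_gen p by blast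
    qed
  qed simp
  have zero: "H.gr_ideal ?F 0 = {0}"
  proof -
    have "x = 0" if x: "x \<in> H.gr_ideal ?F 0" for x
    proof -
      from x obtain p where p: "x = (\<Sum>i\<in>?F. p i * generator i)" "\<forall>i\<in>?F. p i \<in> homog V (0 - int (gen_degree i))"
        unfolding H.gr_ideal_def by blast
      have "p i = 0" if "i \<in> ?F" for i
        using p(2) that weight_pos by (intro homog_negative[of "0 - int (gen_degree i)" "p i" V]) auto
      then show ?thesis using p(1) by simp
    qed
    then show ?thesis using H.gr_ideal_0 by blast
  qed
  have "mons V 0 = {0}"
  proof -
    have "m = 0" if "m \<in> mons V 0" for m
    proof (rule poly_mapping_eqI)
      fix i
      show "lookup m i = lookup 0 i"
        using that lookup_le_wt[of i m] by (cases "i \<in> V") (auto simp: mons_def in_keys_iff)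
    qed
    then show ?thesis by (auto simp: mons_def wt_def)
  qed
  then have "mp.dim (homog V 0) = 1" by (simp add: dim_homog)
  then have "H.hilbert ?F = 1"
    using pos zero by (intro fps_ext) (auto simp: H.hilbert_def mp.dim_zero_subspace)
  also have "1 = H.hilbert {} * (\<Prod>i\<in>V. 1 - fps_X ^ b i)"
    using hilbert_free_eq[OF subset_refl] by (simp add: H.hilbert_empty)
  also have "(\<Prod>i\<in>V. 1 - fps_X ^ b i) = (\<Prod>i\<in>?F. 1 - fps_X ^ gen_degree i :: int fps)"
    by (simp add: prod.reindex)
  finally show ?thesis unfolding H.regular_def .
qed

end

text \<open>The forms with indices \<open>1..n\<close> have the degrees \<open>a j\<close>; those with indices \<open>n + 1..2 * n\<close> have
  degree \<open>L\<close>, a common multiple of all \<open>b i\<close>, and meet every stratum properly. First the variable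
  \<open>i\<close> is exchanged for the form \<open>n + i\<close>, then the form \<open>n + j\<close> for the form \<open>j\<close>. While
  variables remain, only strata in the exchanged variables need equations, and there is one form
  of degree \<open>L\<close> for each of these variables. Later, every form of degree \<open>a j\<close> that is not yet
  present is made up for by one of degree \<open>L\<close>.\<close>

theorem nonneg_quotient_of_semigroup_condition:
  fixes a b :: "nat \<Rightarrow> nat"
  assumes a: "\<And>i. i \<in> {1..n} \<Longrightarrow> a i > 0" and b: "\<And>i. i \<in> {1..n} \<Longrightarrow> b i > 0"
    and enough: "\<And>I. I \<subseteq> {1..n} \<Longrightarrow> card I \<le> card {j \<in> {1..n}. a j \<in> semigroup_span (b ` I)}"
  shows "\<exists>H. fps_nonneg H \<and> H * (\<Prod>i=1..n. 1 - fps_X ^ b i) = (\<Prod>i=1..n. 1 - fps_X ^ a i)"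
proof -
  define L where "L = (\<Prod>i=1..n. b i)"
  define d where "d j = (if j \<in> {1..n} then a j else L)" for j
  define S where "S j = {K. K \<subseteq> {1..n} \<and> K \<noteq> {} \<and> d j \<in> semigroup_span (b ` K)}" for j
  have E_ex: "\<exists>e. (\<forall>i. i \<notin> K \<longrightarrow> e i = 0) \<and> (\<Sum>i=1..n. e i * b i) = d j" if K: "K \<in> S j" for j K
  proof -
    have "finite K" using K unfolding S_def by (auto intro: finite_subset)
    then obtain e where e: "\<forall>i. i \<notin> K \<longrightarrow> e i = 0" "(\<Sum>i\<in>K. e i * b i) = d j"
      using semigroup_span_image_exponents[of K "d j" b] K unfolding S_def by blast
    moreover have "(\<Sum>i=1..n. e i * b i) = (\<Sum>i\<in>K. e i * b i)"
      using K e(1) unfolding S_def by (intro sum.mono_neutral_right) auto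
    ultimately show ?thesis by auto
  qed
  define E where "E j K = (SOME e. (\<forall>i. i \<notin> K \<longrightarrow> e i = 0) \<and> (\<Sum>i=1..n. e i * b i) = d j)" for j K
  have E: "(\<forall>i. i \<notin> K \<longrightarrow> E j K i = 0) \<and> (\<Sum>i=1..n. E j K i * b i) = d j" if "K \<in> S j" for j K
    unfolding E_def by (rule someI_ex[OF E_ex[OF that]])
  have "L > 0" unfolding L_def using b by (simp add: prod_pos)
  \<comment> \<open>The index \<open>0\<close> is a spare form of degree \<open>L\<close>; it never enters the exchange.\<close>
  interpret generic_forms "{1..n}" b "2 * n + 1" d S E
  proof
    show "d j > 0" for j using a \<open>L > 0\<close> by (simp add: d_def)
  qed (use b E in \<open>auto simp: S_def\<close>)
  obtain s where s: "\<forall>I J. I \<subseteq> {1..n} \<longrightarrow> I \<noteq> {} \<longrightarrow> J \<subseteq> {..<2 * n + 1} \<longrightarrow> (\<forall>j\<in>J. I \<in> S j) \<longrightarrow>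
      card I \<le> card J \<longrightarrow> stratum_ok s J I"
    using generic_parameters_exist by blast
  interpret sufficiently_generic_forms "{1..n}" b "2 * n + 1" d S E s
    by unfold_locales (use s in blast)
  have L_in: "I \<in> S j" if I: "I \<subseteq> {1..n}" "I \<noteq> {}" and j: "j > n" for I j
  proof -
    obtain i where i: "i \<in> I" using I(2) by blast
    have "b i dvd L" unfolding L_def using I(1) i by (intro dvd_prodI) auto
    then obtain k where "L = k * b i" by (metis dvdE mult.commute)
    moreover have "b i \<in> semigroup_span (b ` I)"
      using I(1) i by (intro semigroup_span_base) (auto intro: finite_subset)
    ultimately show ?thesis using I j semigroup_span_mult by (simp add: S_def d_def)
  qed
  have stage1: "H.regular (Inl ` {t + 1..n} \<union> Inr ` {n + 1..n + t})" if "t \<le> n" for t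
    using that
  proof (induction t)
    case 0 then show ?case using regular_variables by simp
  next
    case (Suc t)
    let ?F = "Inl ` {t + 2..n} \<union> Inr ` {n + 1..n + t} :: (nat + nat) set"
    have old: "Inl ` {t + 1..n} \<union> Inr ` {n + 1..n + t} = insert (Inl (t + 1)) ?F"
      using Suc.prems by (auto simp: image_iff)
    have new: "Inl ` {Suc t + 1..n} \<union> Inr ` {n + 1..n + Suc t} = insert (Inr (n + t + 1)) ?F"
      by (auto simp: image_iff le_Suc_eq)
    have adm: "admissible (insert (Inr (n + t + 1)) ?F)"
      unfolding admissible_def
    proof (intro allI impI)
      fix I assume I: "I \<subseteq> {1..n}" "I \<noteq> {}" "\<forall>i\<in>I. Inl i \<notin> insert (Inr (n + t + 1)) ?F"
      have "I \<subseteq> {1..t + 1}"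
      proof
        fix i assume "i \<in> I"
        then show "i \<in> {1..t + 1}" using I(1,3) by (auto simp: image_iff not_le subset_iff)
      qed
      then have "card I \<le> t + 1" using card_mono[of "{1..t + 1}" I] by simp
      also have "\<dots> = card {n + 1..n + t + 1}" by simp
      also have "\<dots> \<le> card {j. Inr j \<in> insert (Inr (n + t + 1)) ?F \<and> I \<in> S j}"
      proof (rule card_mono)
        show "finite {j. Inr j \<in> insert (Inr (n + t + 1)) ?F \<and> I \<in> S j}"
          by (rule finite_subset[of _ "{n + 1..n + t + 1}"]) auto
        show "{n + 1..n + t + 1} \<subseteq> {j. Inr j \<in> insert (Inr (n + t + 1)) ?F \<and> I \<in> S j}"
          using L_in[OF I(1,2)] by (auto simp: image_iff le_Suc_eq)
      qed
      finally show "card I \<le> card {j. Inr j \<in> insert (Inr (n + t + 1)) ?F \<and> I \<in> S j}" .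
    qed
    have reg: "H.regular (insert (Inl (t + 1)) ?F)"
      by (rule Suc.IH[OF Suc_leD[OF Suc.prems], unfolded old])
    show ?case unfolding new
    proof (rule regular_replace[OF _ _ _ _ _ reg adm])
      show "insert (Inr (n + t + 1)) ?F \<subseteq> indices" using Suc.prems by (auto simp: image_subset_iff)
    qed (use Suc.prems in auto)
  qed
  have stage2: "H.regular (Inr ` ({1..t} \<union> {n + t + 1..2 * n}))" if "t \<le> n" for t
    using that
  proof (induction t)
    case 0 then show ?case using stage1[of n] by (simp add: mult_2)
  next
    case (Suc t)
    let ?F = "Inr ` ({1..t} \<union> {n + t + 2..2 * n}) :: (nat + nat) set"
    have old: "Inr ` ({1..t} \<union> {n + t + 1..2 * n}) = insert (Inr (n + t + 1)) ?F"
      using Suc.prems by (auto simp: image_iff)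
    have new: "Inr ` ({1..Suc t} \<union> {n + Suc t + 1..2 * n}) = insert (Inr (t + 1)) ?F"
      by (auto simp: image_iff le_Suc_eq)
    have adm: "admissible (insert (Inr (t + 1)) ?F)"
      unfolding admissible_def
    proof (intro allI impI)
      fix I assume I: "I \<subseteq> {1..n}" "I \<noteq> {}"
      let ?T = "{j \<in> {1..t + 1}. I \<in> S j}"
      have "card I \<le> card {j \<in> {1..n}. a j \<in> semigroup_span (b ` I)}" by (rule enough[OF I(1)])
      also have "\<dots> \<le> card (?T \<union> {t + 2..n})"
        using I by (intro card_mono) (auto simp: S_def d_def)
      also have "\<dots> \<le> card ?T + card {t + 2..n}" by (rule card_Un_le)
      also have "card {t + 2..n} = card {n + t + 2..2 * n}" by simp
      also have "card ?T + card {n + t + 2..2 * n} = card (?T \<union> {n + t + 2..2 * n})"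
        using Suc.prems by (intro card_Un_disjoint[symmetric]) auto
      also have "\<dots> \<le> card {j. Inr j \<in> insert (Inr (t + 1)) ?F \<and> I \<in> S j}"
      proof (rule card_mono)
        show "finite {j. Inr j \<in> insert (Inr (t + 1)) ?F \<and> I \<in> S j}"
          by (rule finite_subset[of _ "{1..t + 1} \<union> {n + t + 2..2 * n}"]) auto
        show "?T \<union> {n + t + 2..2 * n} \<subseteq> {j. Inr j \<in> insert (Inr (t + 1)) ?F \<and> I \<in> S j}"
          using L_in[OF I] by (auto simp: image_iff le_Suc_eq)
      qed
      finally show "card I \<le> card {j. Inr j \<in> insert (Inr (t + 1)) ?F \<and> I \<in> S j}" .
    qed
    have reg: "H.regular (insert (Inr (n + t + 1)) ?F)"
      by (rule Suc.IH[OF Suc_leD[OF Suc.prems], unfolded old])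
    show ?case unfolding new
    proof (rule regular_replace[OF _ _ _ _ _ reg adm])
      show "insert (Inr (t + 1)) ?F \<subseteq> indices" using Suc.prems by (auto simp: image_subset_iff)
    qed (use Suc.prems in auto)
  qed
  let ?F = "Inr ` {1..n} :: (nat + nat) set"
  have "H.regular ?F" using stage2[of n] by simp
  then have "H.hilbert ?F = hilbert_free {1..n} * (\<Prod>i=1..n. 1 - fps_X ^ a i)"
    unfolding H.regular_def H.hilbert_empty by (simp add: prod.reindex d_def)
  then have "H.hilbert ?F * (\<Prod>i=1..n. 1 - fps_X ^ b i)
      = hilbert_free {1..n} * (\<Prod>i=1..n. 1 - fps_X ^ b i) * (\<Prod>i=1..n. 1 - fps_X ^ a i)"
    by (simp only: mult_ac)
  also have "\<dots> = (\<Prod>i=1..n. 1 - fps_X ^ a i)" by (simp only: hilbert_free_eq[OF subset_refl] mult_1)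
  finally have "H.hilbert ?F * (\<Prod>i=1..n. 1 - fps_X ^ b i) = (\<Prod>i=1..n. 1 - fps_X ^ a i)" .
  moreover have "fps_nonneg (H.hilbert ?F)" by (rule H.hilbert_nonneg) auto
  ultimately show ?thesis by blast
qed

section \<open>The two conclusions\<close>

lemma size_mset_cap: "size (sub_mset a S \<inter>\<^sub>#\<^sub>s T) = card {i \<in> S. a i \<in> T}" if "finite S"
  using that by (simp add: sub_mset_def mset_cap_def filter_mset_image_mset filter_mset_mset_set)

lemma q_quotient_eq_iff:
  assumes "\<And>i. i \<in> {1..n} \<Longrightarrow> b i > 0"
  shows "q_quotient n a b = to_fract p \<longleftrightarrow>
    p * (\<Prod>i=1..n. 1 - monom 1 (b i)) = (\<Prod>i=1..n. 1 - monom 1 (a i))"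
proof -
  have monom: "monom 1 1 ^ k = (monom 1 k :: int poly)" for k
    by (induction k) (simp_all add: mult_monom)
  have prod: "to_fract (\<Prod>i=1..n. f i) = (\<Prod>i=1..n. to_fract (f i))" for f :: "nat \<Rightarrow> int poly"
    by (induction n) simp_all
  have nz: "(\<Prod>i=1..n. 1 - monom 1 (b i)) \<noteq> (0 :: int poly)"
    using assms one_minus_monom_nonzero[where 'a = int] by (simp add: prod_zero_iff del: One_nat_def)
  have "q_quotient n a b = to_fract (\<Prod>i=1..n. 1 - monom 1 (a i)) / to_fract (\<Prod>i=1..n. 1 - monom 1 (b i))"
    unfolding q_quotient_def monom prod by (rule prod_dividef)
  also have "\<dots> = to_fract p \<longleftrightarrow> to_fract (\<Prod>i=1..n. 1 - monom 1 (a i)) = to_fract (p * (\<Prod>i=1..n. 1 - monom 1 (b i)))"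
    using nz by (simp add: nonzero_divide_eq_eq)
  also have "\<dots> \<longleftrightarrow> p * (\<Prod>i=1..n. 1 - monom 1 (b i)) = (\<Prod>i=1..n. 1 - monom 1 (a i))"
    unfolding to_fract_eq_iff by (rule eq_commute)
  finally show ?thesis .
qed

text \<open>If the \<open>b i\<close> with \<open>i \<in> I\<close> take only one value, that value is the gcd and all its multiples are in
  the semigroup. Otherwise their minimum is strictly below their maximum, and the
  size condition provides Schur's bound.\<close>

lemma enough_in_semigroup_span:
  fixes a b :: "nat \<Rightarrow> nat"
  assumes "finite S" and b: "\<And>i. i \<in> S \<Longrightarrow> b i > 0"
    and divisors: "\<And>d. d > 0 \<Longrightarrow> card {i \<in> S. d dvd b i} \<le> card {i \<in> S. d dvd a i}"
    and large: "\<And>i j k. i \<in> S \<Longrightarrow> j \<in> S \<Longrightarrow> k \<in> S \<Longrightarrow> b i < b j \<Longrightarrow> (b i - 1) * b j < a k + b i"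
    and I: "I \<subseteq> S"
  shows "card I \<le> card {j \<in> S. a j \<in> semigroup_span (b ` I)}"
proof (cases "I = {}")
  case True then show ?thesis by simp
next
  case False
  let ?B = "b ` I" and ?g = "Gcd (b ` I)"
  have finB: "finite ?B" using I \<open>finite S\<close> finite_subset by blast
  have B_ne: "?B \<noteq> {}" using False by simp
  obtain i where i: "i \<in> I" "b i = Min ?B" using Min_in[OF finB B_ne] by auto
  obtain j where j: "j \<in> I" "b j = Max ?B" using Max_in[OF finB B_ne] by auto
  have bi: "b i > 0" using b i(1) I by blast
  have "?g > 0" using i(1) bi by (metis Gcd_0_iff gr0I image_subset_iff less_numeral_extra(3) singletonD)
  have in_span: "a k \<in> semigroup_span ?B" if k: "k \<in> S" "?g dvd a k" for k
  proof (cases "b i = b j")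
    case True
    have "?B = {b i}"
    proof -
      have "b l = b i" if "l \<in> I" for l
        using Min_le[OF finB, of "b l"] Max_ge[OF finB, of "b l"] that i j True by force
      then have "?B \<subseteq> {b i}" by blast
      then show ?thesis using B_ne subset_singletonD by metis
    qed
    then have "b i dvd a k" using k(2) by simp
    then obtain c where "a k = b i * c" by (rule dvdE)
    then have "a k = c * b i" by (simp only: mult.commute)
    then show ?thesis using i(1) by (simp add: semigroup_span_mult semigroup_span_base[OF finB])
  next
    case False
    have "b i \<le> b j" using i j Min_le[OF finB] by (metis imageI)
    then have "(b i - 1) * b j < a k + b i" using large[of i j k] i(1) j(1) I k(1) False by auto
    then show ?thesis
      using Max_ge[OF finB] j(2) i(1) bi k(2)
      by (intro multiple_of_Gcd_in_semigroup_span[OF finB, of "b i" _ "b j"]) auto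
  qed
  have "card I \<le> card {i \<in> S. ?g dvd b i}" using I \<open>finite S\<close> by (intro card_mono) auto
  also have "\<dots> \<le> card {i \<in> S. ?g dvd a i}" by (rule divisors[OF \<open>?g > 0\<close>])
  also have "\<dots> \<le> card {j \<in> S. a j \<in> semigroup_span ?B}"
    using in_span \<open>finite S\<close> by (intro card_mono) auto
  finally show ?thesis .
qed

theorem theorem1p6:
  fixes n :: nat and a b :: "nat \<Rightarrow> nat" and A :: "nat multiset"
  assumes "n \<ge> 2"
    and "\<forall>i\<in>{1..n}. a i > 0" and "\<forall>i\<in>{1..n}. b i > 0"
    and "\<forall>i\<in>{1..n-1}. a i \<le> a (i + 1)" and "\<forall>i\<in>{1..n-1}. b i \<le> b (i + 1)"
    and "A = sub_mset a {1..n}"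
    and "q_quotient n a b \<in> int_polys"
    and "2 * int (b n) * \<lfloor>real (b (n - 1)) / 2\<rfloor> - int (b 1) < int (a 1)"
  shows "(\<forall>I\<subseteq>{1..n}. size (A \<inter>\<^sub>#\<^sub>s semigroup_span (set_mset (sub_mset b I))) \<ge> card I)
       \<and> q_quotient n a b \<in> nonneg_int_polys"
proof -
  have a: "a i > 0" and b: "b i > 0" if "i \<in> {1..n}" for i using assms(2,3) that by auto
  have mono: "f i \<le> f j" if "\<forall>i\<in>{1..n-1}. f i \<le> f (i + 1)" "1 \<le> i" "i \<le> j" "j \<le> n"
    for f :: "nat \<Rightarrow> nat" and i j
    using that(3,4)
  proof (induction j rule: dec_induct)
    case (step k)
    then have "f k \<le> f (k + 1)" using that(1,2) by auto
    then show ?case using step by simp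
  qed simp
  obtain p where p: "q_quotient n a b = to_fract p" using assms(7) unfolding int_polys_def by blast
  have eq: "p * (\<Prod>i=1..n. 1 - monom 1 (b i)) = (\<Prod>i=1..n. 1 - monom 1 (a i))"
    using p q_quotient_eq_iff[of n b a p] b by blast
  have large: "(b i - 1) * b j < a k + b i"
    if ijk: "i \<in> {1..n}" "j \<in> {1..n}" "k \<in> {1..n}" "b i < b j" for i j k
  proof -
    have bj: "b j \<le> b n" using mono[OF assms(5), of j n] ijk(2) by simp
    then have "i \<noteq> n" using ijk(4) by auto
    then have "1 \<le> i" "i \<le> n - 1" using ijk(1) by auto
    then have bi: "b i \<le> b (n - 1)" using mono[OF assms(5), of i "n - 1"] by simp
    \<comment> \<open>As \<open>b i < b j\<close>, the index \<open>i\<close> is not \<open>n\<close>, and \<open>b i - 1\<close> is at most twice the rounded-down half of \<open>b (n - 1)\<close>.\<close>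
    have "\<lfloor>real (b (n - 1)) / 2\<rfloor> = int (b (n - 1) div 2)"
      by (metis floor_divide_of_nat_eq of_nat_numeral)
    then have "2 * int (b n) * int (b (n - 1) div 2) - int (b 1) < int (a 1)" using assms(8) by simp
    then have bound: "2 * b n * (b (n - 1) div 2) < a 1 + b 1"
      by (metis diff_less_eq of_nat_add of_nat_less_iff of_nat_mult of_nat_numeral)
    have "(b i - 1) * b j \<le> (2 * (b (n - 1) div 2)) * b n"
      using bi bj by (intro mult_mono) auto
    also have "\<dots> < a 1 + b 1" using bound by (simp add: mult_ac)
    also have "\<dots> \<le> a k + b i"
      using mono[OF assms(4), of 1 k] mono[OF assms(5), of 1 i] ijk by (intro add_mono) auto
    finally show ?thesis .
  qed
  have enough: "card I \<le> card {j \<in> {1..n}. a j \<in> semigroup_span (b ` I)}" if "I \<subseteq> {1..n}" for I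
    by (rule enough_in_semigroup_span[OF _ b _ large that])
      (use card_multiples_le[of "{1..n}" a b _ p, OF _ a b _ eq] in auto)
  have "size (A \<inter>\<^sub>#\<^sub>s semigroup_span (set_mset (sub_mset b I))) \<ge> card I" if I: "I \<subseteq> {1..n}" for I
  proof -
    have "set_mset (sub_mset b I) = b ` I"
      using finite_subset[OF I] by (simp add: sub_mset_def)
    then show ?thesis using enough[OF I] by (simp add: assms(6) size_mset_cap)
  qed
  moreover have "q_quotient n a b \<in> nonneg_int_polys"
  proof -
    obtain H where H: "fps_nonneg H" "H * (\<Prod>i=1..n. 1 - fps_X ^ b i) = (\<Prod>i=1..n. 1 - fps_X ^ a i)"
      using nonneg_quotient_of_semigroup_condition[OF a b enough] by blast
    have "fps_of_poly p * (\<Prod>i=1..n. 1 - fps_X ^ b i) = (\<Prod>i=1..n. 1 - fps_X ^ a i)"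
      using arg_cong[OF eq, of fps_of_poly]
      by (simp add: fps_of_poly_mult fps_of_poly_prod fps_of_poly_diff fps_of_poly_monom')
    moreover have "(\<Prod>i=1..n. 1 - fps_X ^ b i) \<noteq> (0 :: int fps)"
      using b one_minus_fps_X_power_neq_0 by (simp add: prod_zero_iff del: One_nat_def)
    ultimately have "fps_of_poly p = H" using H(2) by (metis mult_right_cancel)
    then have "coeff p k \<ge> 0" for k using H(1) unfolding fps_nonneg_def by auto
    then show ?thesis unfolding nonneg_int_polys_def p by blast
  qed
  ultimately show ?thesis by blast
qed

end
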